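(* For every $n\ge 2$ and all $t\in\mathbb{F}_2^{n+1}$, $t'\in\mathbb{F}_2^{n}$, $t''\in\mathbb{F}_2^{n-1}$, there is an equality of multiplicities $$e(R(n,t))=e(R(n-1,t'))+e(R(n-2,t'')).$$ In particular, for every $n\ge 0$ and every $t\in\mathbb{F}_2^{n+1}$, $$e(R(n,t))=F(n+3)=\frac{(1+\sqrt5)^{n+3}-(1-\sqrt5)^{n+3}}{2^{n+3}\sqrt5},$$ where $F$ is the Fibonacci sequence with $F(0)=0$, $F(1)=1$.
   Context: Throughout, $k$ is a field. Ladder-like structures. For $n\ge 0$ and $t=(t_1,\dots,t_{n+1})\in\mathbb{F}_2^{n+1}$, $L_n^t$ is a partially filled array with $\lfloor n/2\rfloor+2$ rows (numbered top to bottom) and $\lceil n/2\rceil+2$ columns (numbered left to right); its nonzero entries are the variables $x_0,x_2,x_3,\dots,x_{2n+4}$ (there is no $x_1$), each occurring exactly once, all other positions being empty. It is defined recursively, with $\widehat t=(t_1,\dots,t_n)$: - $L_0^t$ has first row $x_0,x_2$ and second row $x_3,x_4$ (for both values of $t$). - $L_1^t$ has first row $x_0,x_2,x_5$ and second row $x_3,x_4,x_6$ (for all $t$). - For $n\ge 2$ even, $L_n^t$ is $L_{n-1}^{\widehat t}$ with a new bottom row added whose only nonzero entries are $x_{2n+4}$, in the last column, and $x_{2n+3}$, in the column containing the first (if $t_{n+1}=0$) or the second (if $t_{n+1}=1$) nonzero entry, from left to right, of the row immediately above the new row. - For $n\ge 3$ odd, $L_n^t$ is $L_{n-1}^{\widehat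 t}$ with a new rightmost column added whose only nonzero entries are $x_{2n+4}$, in the last row, and $x_{2n+3}$, in the row containing the first (if $t_{n+1}=0$) or the second (if $t_{n+1}=1$) nonzero entry, from top to bottom, of the column immediately to the left of the new column. Graphs and toric rings. $G_n^t$ is the bipartite graph with one vertex for each row and one vertex for each column of $L_n^t$, and, for each nonzero entry $x_j$ of $L_n^t$, one edge (called $x_j$) joining the vertex of its row to the vertex of its column. Let $V$ be its vertex set, $S(n)=k[x_0,x_2,x_3,\dots,x_{2n+4}]$ the polynomial ring on the edges, and $I_{G_n^t}$ (the toric ideal) the kernel of the $k$-algebra homomorphism $S(n)\to k[V]$ sending each edge to the product of its two endpoints. The toric ring is $R(n,t)=S(n)/I_{G_n^t}$, graded with all variables in degree 1. The multiplicity of a standard graded $k$-algebra $R$ of Krull dimension $d$ with Hilbert series $\mathrm{Hilb}_R(z)$ is $e(R)=\big(\mathrm{Hilb}_R(z)(1-z)^d\big)\big|_{z=1}$. *)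

theory Defs
  imports
    "HOL-Library.Poly_Mapping"
    "HOL-Library.Z2"
    "HOL-Library.Extended_Nat"
    "HOL-Algebra.QuotRing"
    "HOL-Algebra.Embedded_Algebras"
    "HOL-Computational_Algebra.Polynomial_FPS"
    "HOL-Number_Theory.Fib"
    Complex_Main
begin

section \<open>Graded algebras, Krull dimension, multiplicity\<close>

text \<open>
  The length of a chain of primes is its number of strict inclusions; the supremum is
  taken in \<^typ>\<open>enat\<close>, so that rings of infinite dimension do not get a junk finite value.
\<close>

definition krull_dim :: "('a, 'b) ring_scheme \<Rightarrow> enat" where
  "krull_dim R = Sup {enat n | n.
     \<exists>P. (\<forall>i\<le>n. primeideal (P i) R) \<and> (\<forall>i<n. P i \<subset> P (Suc i))}"

text \<open>
  An algebra over a field is a ring together with the image of the field in it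
  (\<open>scalars\<close>); this is the form in which \<^theory>\<open>HOL-Algebra.Embedded_Algebras\<close> measures
  vector space dimension (\<open>ring.dim\<close>). The graded components are the sets \<open>component d\<close>.
\<close>

record 'a graded_algebra =
  alg_ring :: "'a ring"
  scalars :: "'a set"
  component :: "nat \<Rightarrow> 'a set"

definition hilbert_function :: "'a graded_algebra \<Rightarrow> nat \<Rightarrow> nat" where
  "hilbert_function A d = ring.dim (alg_ring A) (scalars A) (component A d)"

definition hilbert_series :: "'a graded_algebra \<Rightarrow> int fps" where
  "hilbert_series A = Abs_fps (\<lambda>d. int (hilbert_function A d))"

text \<open>
  A formal power series cannot be evaluated at 1; for a standard graded algebra,
  however, the series below is a polynomial, and it is this polynomial that is evaluated.
\<close>

definition hilbert_multiplicity :: "'a graded_algebra \<Rightarrow> int" where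
  "hilbert_multiplicity A =
     poly (THE p. fps_of_poly p =
       hilbert_series A * (1 - fps_X) ^ the_enat (krull_dim (alg_ring A))) 1"


section \<open>Polynomial rings\<close>

text \<open>
  A monomial is a finitely supported map from variables to exponents, a polynomial a finitely
  supported map from monomials to coefficients.
\<close>

type_synonym ('x, 'k) mpoly = "('x \<Rightarrow>\<^sub>0 nat) \<Rightarrow>\<^sub>0 'k"

definition mpoly_const :: "'k::field \<Rightarrow> ('x, 'k) mpoly" where
  "mpoly_const c = Poly_Mapping.single 0 c"

definition mpoly_var :: "'x \<Rightarrow> ('x, 'k::field) mpoly" where
  "mpoly_var x = Poly_Mapping.single (Poly_Mapping.single x 1) 1"

definition mpoly_ring :: "'x set \<Rightarrow> ('x, 'k::field) mpoly ring" where
  "mpoly_ring X =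
     \<lparr>carrier = {p. \<forall>m\<in>Poly_Mapping.keys p. Poly_Mapping.keys m \<subseteq> X},
      monoid.mult = (*), one = 1, zero = 0, add = (+)\<rparr>"

definition homogeneous :: "nat \<Rightarrow> ('x, 'k::field) mpoly \<Rightarrow> bool" where
  "homogeneous d p \<longleftrightarrow>
     (\<forall>m\<in>Poly_Mapping.keys p. (\<Sum>x\<in>Poly_Mapping.keys m. Poly_Mapping.lookup m x) = d)"

text \<open>The algebra homomorphism sending each variable \<open>x\<close> to \<open>f x\<close>.\<close>

definition mpoly_subst ::
    "('x \<Rightarrow> ('y, 'k::field) mpoly) \<Rightarrow> ('x, 'k) mpoly \<Rightarrow> ('y, 'k) mpoly" where
  "mpoly_subst f p =
     (\<Sum>m\<in>Poly_Mapping.keys p. mpoly_const (Poly_Mapping.lookup p m) *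
        (\<Prod>x\<in>Poly_Mapping.keys m. f x ^ Poly_Mapping.lookup m x))"


section \<open>Toric rings of graphs\<close>

record ('v, 'e) graph =
  verts :: "'v set"
  edges :: "'e set"
  ends :: "'e \<Rightarrow> 'v set"

definition toric_map :: "('v, 'e) graph \<Rightarrow> ('e, 'k::field) mpoly \<Rightarrow> ('v, 'k) mpoly" where
  "toric_map G = mpoly_subst (\<lambda>e. \<Prod>v\<in>ends G e. mpoly_var v)"

definition toric_ideal :: "('v, 'e) graph \<Rightarrow> ('e, 'k::field) mpoly set" where
  "toric_ideal G = a_kernel (mpoly_ring (edges G)) (mpoly_ring (verts G)) (toric_map G)"

definition toric_ring :: "('v, 'e) graph \<Rightarrow> ('e, 'k::field) mpoly set graded_algebra" where
  "toric_ring G =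
     (let S = mpoly_ring (edges G); I = toric_ideal G in
      \<lparr>alg_ring = S Quot I,
       scalars = {I +>\<^bsub>S\<^esub> mpoly_const c | c. True},
       component = (\<lambda>d. {I +>\<^bsub>S\<^esub> p | p. p \<in> carrier S \<and> homogeneous d p})\<rparr>)"


section \<open>Ladder-like structures\<close>

text \<open>
  A partially filled array maps a position (row, column), both numbered from 1, to the index
  \<open>j\<close> of the entry \<open>x\<^sub>j\<close>, and an empty position to \<^const>\<open>None\<close>. A vector
  \<open>(t\<^sub>1, \<dots>, t\<^sub>n\<^sub>+\<^sub>1)\<close> over the field with two elements is a list of length \<open>n + 1\<close>.
\<close>

definition num_rows :: "nat \<Rightarrow> nat" where
  "num_rows n = n div 2 + 2"

definition num_cols :: "nat \<Rightarrow> nat" where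
  "num_cols n = (n + 1) div 2 + 2"

definition row_support :: "(nat \<times> nat \<rightharpoonup> nat) \<Rightarrow> nat \<Rightarrow> nat list" where
  "row_support L i = sorted_list_of_set {j. (i, j) \<in> dom L}"

definition col_support :: "(nat \<times> nat \<rightharpoonup> nat) \<Rightarrow> nat \<Rightarrow> nat list" where
  "col_support L j = sorted_list_of_set {i. (i, j) \<in> dom L}"

fun ladder_array :: "nat \<Rightarrow> bit list \<Rightarrow> (nat \<times> nat \<rightharpoonup> nat)" where
  "ladder_array 0 t = [(1, 1) \<mapsto> 0, (1, 2) \<mapsto> 2,
                 (2, 1) \<mapsto> 3, (2, 2) \<mapsto> 4]"
| "ladder_array (Suc 0) t = [(1, 1) \<mapsto> 0, (1, 2) \<mapsto> 2, (1, 3) \<mapsto> 5,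
                       (2, 1) \<mapsto> 3, (2, 2) \<mapsto> 4, (2, 3) \<mapsto> 6]"
| "ladder_array (Suc (Suc m)) t =
     (let n = Suc (Suc m);
          L = ladder_array (Suc m) (butlast t);
          r = num_rows n;
          c = num_cols n;
          k = (if last t = 0 then 0 else 1)
      in if even n
         then L((r, c) \<mapsto> 2 * n + 4, (r, row_support L (r - 1) ! k) \<mapsto> 2 * n + 3)
         else L((r, c) \<mapsto> 2 * n + 4, (col_support L (c - 1) ! k, c) \<mapsto> 2 * n + 3))"

text \<open>The vertex \<^term>\<open>Inl i\<close> is row \<open>i\<close>, the vertex \<^term>\<open>Inr j\<close> is column \<open>j\<close>.\<close>

definition ladder_graph :: "nat \<Rightarrow> bit list \<Rightarrow> (nat + nat, nat) graph" where
  "ladder_graph n t =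
     \<lparr>verts = Inl ` {1..num_rows n} \<union> Inr ` {1..num_cols n},
      edges = ran (ladder_array n t),
      ends = (\<lambda>e. \<Union>{{Inl i, Inr j} | i j. ladder_array n t (i, j) = Some e})\<rparr>"

definition ladder_ring :: "nat \<Rightarrow> bit list \<Rightarrow> (nat, 'k::field) mpoly set graded_algebra" where
  "ladder_ring n t = toric_ring (ladder_graph n t)"

text \<open>The multiplicity \<open>e(R(n,t))\<close>; the type argument is the ground field.\<close>

definition ladder_mult :: "'k::field itself \<Rightarrow> nat \<Rightarrow> bit list \<Rightarrow> int" where
  "ladder_mult _ n t = hilbert_multiplicity (ladder_ring n t :: (nat, 'k) mpoly set graded_algebra)"

end

theory Submission
  imports Defs
begin

text \<open>
  The multiplicity is read off from the Hilbert series, so both the Hilbert function and the Krull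
  dimension of \<open>R(n,t)\<close> are needed.

  The toric ring of a graph \<open>G\<close> is the monoid algebra of the monoid generated by the
  edges in \<open>\<nat>\<^sup>V\<close>, where an edge is the sum of the unit vectors of its endpoints. Hence its Hilbert
  function at \<open>d\<close> counts the vectors that are sums of \<open>d\<close> edges
  (\<open>hilbert_function_toric_ring\<close>, \<open>deg_vecs_eq_edge_sums\<close>).

  The Krull dimension is one less than the number \<open>N\<close> of vertices, for every connected bipartite
  graph (\<open>krull_dim_connected_bipartite\<close>). A chain of primes of length \<open>N - 1\<close> is obtained by
  setting to 1 one vertex after the other, in an order in which each vertex is adjacent to an
  earlier one. Conversely, choose one element from each step of a chain of primes of length
  \<open>m\<close>: the monomials in these \<open>m\<close> elements are linearly independent modulo the smallest prime,
  so the algebra grows at least like a polynomial of degree \<open>m\<close>. But a sum of at most \<open>D\<close> edges is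
  determined by all but one of its coordinates, since both sides of the bipartition have the same
  coordinate sum; so the growth has degree at most \<open>N - 1\<close>.

  For the Hilbert series, suppose that \<open>G\<close> arises from \<open>G'\<close> by adding a vertex \<open>v\<close> with neighbours
  \<open>p\<close> and \<open>q\<close>, where every neighbour \<open>y\<close> of \<open>p\<close> in \<open>G'\<close> is also a neighbour of \<open>q\<close>. The relation
  \<open>{v,q} + {p,y} = {v,p} + {q,y}\<close> then replaces the edge \<open>{v,q}\<close> by \<open>{v,p}\<close> as long as some edge
  \<open>{p,y}\<close> of \<open>G'\<close> is in use. So each sum of edges is uniquely \<open>i{v,p} + b\<close> with \<open>b\<close> a sum of edges of
  \<open>G'\<close>, or \<open>i{v,p} + (j+1){v,q} + b\<close> with \<open>b\<close> a sum of edges of \<open>G' - p\<close>; which of the two holds is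
  visible from the coordinates at \<open>v\<close> and \<open>p\<close>. This gives
  \<open>H(G) = H(G') / (1 - z) + z H(G' - p) / (1 - z)\<^sup>2\<close> (\<open>edge_series_ear\<close>).

  The last row or column of the ladder-like structure is such a vertex \<open>v\<close>, with \<open>p\<close> the vertex
  added just before. For \<open>n \<ge> 2\<close>, \<open>G' - p\<close> is again a ladder graph, with index \<open>n - 2\<close>; for \<open>n = 1\<close>
  it is the path with two edges, and for \<open>n = 0\<close> a single edge. Since the dimension grows by one
  in each step, the numerators satisfy \<open>h\<^sub>n = h\<^bsub>n-1\<^esub> + z h\<^bsub>n-2\<^esub>\<close> whatever \<open>t\<close> is, and at \<open>z = 1\<close> this is the
  Fibonacci recursion.
\<close>

section \<open>Monoid algebras\<close>

abbreviation "lookup \<equiv> Poly_Mapping.lookup"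
abbreviation "keys \<equiv> Poly_Mapping.keys"
abbreviation "single \<equiv> Poly_Mapping.single"

lemma poly_mapping_sum_single: "(\<Sum>m\<in>keys p. single m (lookup p m)) = p"
  apply (rule poly_mapping_eqI)
  apply (simp add: lookup_sum lookup_single when_def)
  apply (simp add: not_in_keys_iff_lookup_eq_zero)
  done

text \<open>
  The pushforward of finitely supported functions. For an additive map it is the induced
  homomorphism of monoid algebras; toric maps and the substitution of 1 for variables are both of
  this form.
\<close>

definition push :: "('a \<Rightarrow> 'b) \<Rightarrow> ('a \<Rightarrow>\<^sub>0 'k::comm_monoid_add) \<Rightarrow> ('b \<Rightarrow>\<^sub>0 'k)" where
  "push d p = (\<Sum>m\<in>keys p. single (d m) (lookup p m))"

lemma push_superset: "finite S \<Longrightarrow> keys p \<subseteq> S \<Longrightarrow> push d p = (\<Sum>m\<in>S. single (d m) (lookup p m))"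
  unfolding push_def by (rule sum.mono_neutral_left) (auto simp: in_keys_iff)

lemma push_zero [simp]: "push d 0 = 0"
  by (simp add: push_def)

lemma push_single [simp]: "push d (single m c) = single (d m) c"
  by (simp add: push_def)

lemma push_add: "push d (p + q) = push d p + push d q"
proof -
  have "push d (p + q) = (\<Sum>m\<in>keys p \<union> keys q. single (d m) (lookup (p + q) m))"
    by (rule push_superset) (auto simp: keys_add)
  also have "\<dots> = push d p + push d q"
    by (simp add: lookup_add single_add sum.distrib push_superset[of "keys p \<union> keys q"])
  finally show ?thesis .
qed

lemma push_sum: "push d (\<Sum>i\<in>I. f i) = (\<Sum>i\<in>I. push d (f i))"
  by (induction I rule: infinite_finite_induct) (auto simp: push_add)

lemma push_push: "push e (push d p) = push (e \<circ> d) p"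
  by (simp add: push_def[of d] push_sum) (simp add: push_def)

lemma push_mult:
  fixes p q :: "'a::monoid_add \<Rightarrow>\<^sub>0 'k::semiring_0"
  assumes "\<And>m m'. d (m + m') = d m + d m'"
  shows "push d (p * q) = push d p * push d q"
proof -
  have "p * q = (\<Sum>m\<in>keys p. \<Sum>m'\<in>keys q. single m (lookup p m) * single m' (lookup q m'))"
    by (simp add: sum_product[symmetric] poly_mapping_sum_single)
  then have "push d (p * q) = (\<Sum>m\<in>keys p. \<Sum>m'\<in>keys q. single (d m) (lookup p m) * single (d m') (lookup q m'))"
    by (simp add: push_sum mult_single assms)
  also have "\<dots> = push d p * push d q"
    by (simp add: sum_product[symmetric] push_def)
  finally show ?thesis .
qed

lemma push_minus:
  fixes p q :: "'a \<Rightarrow>\<^sub>0 'k::ab_group_add"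
  shows "push d (p - q) = push d p - push d q"
  using push_add[of d "p - q" q] by simp

lemma keys_push: "keys (push d p) \<subseteq> d ` keys p"
proof
  fix x assume "x \<in> keys (push d p)"
  then have "(\<Sum>m\<in>keys p. lookup (single (d m) (lookup p m)) x) \<noteq> 0"
    by (simp add: in_keys_iff push_def lookup_sum)
  then obtain m where "m \<in> keys p" "lookup (single (d m) (lookup p m)) x \<noteq> 0"
    by (meson sum.neutral)
  then show "x \<in> d ` keys p" by (auto simp: lookup_single when_def split: if_splits)
qed

text \<open>
  Choosing a preimage of each exponent of \<open>q\<close> gives a preimage of \<open>q\<close>; the choice need not be additive.
\<close>

lemma push_surj:
  assumes "keys q \<subseteq> d ` M"
  shows "\<exists>p. keys p \<subseteq> M \<and> push d p = q"
proof -
  have "\<forall>a\<in>keys q. \<exists>m. m \<in> M \<and> d m = a" using assms by auto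
  then obtain s where s: "\<And>a. a \<in> keys q \<Longrightarrow> s a \<in> M \<and> d (s a) = a" by metis
  have "push d (push s q) = (\<Sum>m\<in>keys q. single (d (s m)) (lookup q m))"
    by (simp only: push_push) (simp add: push_def)
  also have "\<dots> = (\<Sum>m\<in>keys q. single m (lookup q m))"
    by (rule sum.cong) (auto dest: s)
  finally have "push d (push s q) = q" by (simp only: poly_mapping_sum_single)
  moreover have "keys (push s q) \<subseteq> M" using keys_push[of s q] s by blast
  ultimately show ?thesis by blast
qed

definition monoid_algebra :: "'a::comm_monoid_add set \<Rightarrow> ('a \<Rightarrow>\<^sub>0 'k::field) ring" where
  "monoid_algebra M = \<lparr>carrier = {p. keys p \<subseteq> M},
      monoid.mult = (*), one = 1, zero = 0, add = (+)\<rparr>"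

lemma monoid_algebra_simps [simp]:
  "carrier (monoid_algebra M) = {p. keys p \<subseteq> M}"
  "p \<otimes>\<^bsub>monoid_algebra M\<^esub> q = p * q" "p \<oplus>\<^bsub>monoid_algebra M\<^esub> q = p + q"
  "\<one>\<^bsub>monoid_algebra M\<^esub> = 1" "\<zero>\<^bsub>monoid_algebra M\<^esub> = 0"
  by (simp_all add: monoid_algebra_def)

definition additive_submonoid :: "'a::comm_monoid_add set \<Rightarrow> bool" where
  "additive_submonoid M \<longleftrightarrow> 0 \<in> M \<and> (\<forall>a\<in>M. \<forall>b\<in>M. a + b \<in> M)"

lemma keys_mult_sub:
  assumes "additive_submonoid M" "keys p \<subseteq> M" "keys q \<subseteq> M" shows "keys (p * q) \<subseteq> M"
  using keys_mult[of p q] assms unfolding additive_submonoid_def by blast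

lemma monoid_algebra_cring:
  assumes "additive_submonoid M"
  shows "cring (monoid_algebra M :: ('a::comm_monoid_add \<Rightarrow>\<^sub>0 'k::field) ring)"
proof (rule cringI)
  show "abelian_group (monoid_algebra M :: ('a \<Rightarrow>\<^sub>0 'k) ring)"
  proof (rule abelian_groupI)
    fix x :: "'a \<Rightarrow>\<^sub>0 'k" assume "x \<in> carrier (monoid_algebra M)"
    then show "\<exists>y\<in>carrier (monoid_algebra M). y \<oplus>\<^bsub>monoid_algebra M\<^esub> x = \<zero>\<^bsub>monoid_algebra M\<^esub>"
      by (intro bexI[of _ "- x"]) (auto simp: in_keys_iff)
  next
    fix x y :: "'a \<Rightarrow>\<^sub>0 'k" assume "x \<in> carrier (monoid_algebra M)" "y \<in> carrier (monoid_algebra M)"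
    then show "x \<oplus>\<^bsub>monoid_algebra M\<^esub> y \<in> carrier (monoid_algebra M)"
      using keys_add[of x y] by auto
  qed (simp_all add: add.assoc add.commute)
  show "Group.comm_monoid (monoid_algebra M :: ('a \<Rightarrow>\<^sub>0 'k) ring)"
    by (rule comm_monoidI)
       (use assms keys_mult_sub[OF assms] in \<open>simp_all add: mult.assoc mult.commute additive_submonoid_def\<close>)
qed (simp add: distrib_right)

lemma push_one: "d 0 = 0 \<Longrightarrow> push d 1 = (1 :: 'b::monoid_add \<Rightarrow>\<^sub>0 'k::semiring_1)"
  using push_single[of d 0 "1::'k"] by simp

lemma push_ring_hom:
  assumes "\<And>m m'. d (m + m') = d m + d m'" "d 0 = 0" "d ` M \<subseteq> N"
  shows "push d \<in> ring_hom (monoid_algebra M :: ('a::comm_monoid_add \<Rightarrow>\<^sub>0 'k::field) ring) (monoid_algebra N)"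
proof (rule ring_hom_memI)
  fix x :: "'a \<Rightarrow>\<^sub>0 'k" assume "x \<in> carrier (monoid_algebra M)"
  then show "push d x \<in> carrier (monoid_algebra N)"
    using keys_push[of d x] assms(3) by simp blast
qed (simp_all add: push_add push_mult push_one assms)

section \<open>Chains of prime ideals\<close>

lemma primeideal_vimage:
  assumes "cring R" "cring S" "h \<in> ring_hom R S" "primeideal P S"
  shows "primeideal {r \<in> carrier R. h r \<in> P} R"
proof -
  interpret R: cring R by fact
  interpret S: cring S by fact
  interpret h: ring_hom_ring R S h
    by (rule ring_hom_ringI2) (use assms in \<open>simp_all add: R.ring_axioms S.ring_axioms\<close>)
  interpret P: primeideal P S by fact
  show ?thesis
  proof (rule primeidealI)
    show "ideal {r \<in> carrier R. h r \<in> P} R" by (rule h.ideal_vimage) (rule P.is_ideal)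
    have "h \<one>\<^bsub>R\<^esub> \<notin> P" using P.I_notcarr P.one_imp_carrier by auto
    then show "carrier R \<noteq> {r \<in> carrier R. h r \<in> P}" by blast
    fix a b assume "a \<in> carrier R" "b \<in> carrier R" "a \<otimes>\<^bsub>R\<^esub> b \<in> {r \<in> carrier R. h r \<in> P}"
    then show "a \<in> {r \<in> carrier R. h r \<in> P} \<or> b \<in> {r \<in> carrier R. h r \<in> P}"
      using P.I_prime[of "h a" "h b"] by auto
  qed (fact assms)
qed

definition prime_chain :: "('a, 'b) ring_scheme \<Rightarrow> nat \<Rightarrow> (nat \<Rightarrow> 'a set) \<Rightarrow> bool" where
  "prime_chain R n P \<longleftrightarrow> (\<forall>i\<le>n. primeideal (P i) R) \<and> (\<forall>i<n. P i \<subset> P (Suc i))"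

lemma prime_chain_vimage:
  assumes "cring R" "cring S" "h \<in> ring_iso R S" "prime_chain S n P"
  shows "prime_chain R n (\<lambda>i. {r \<in> carrier R. h r \<in> P i})"
  unfolding prime_chain_def
proof (intro conjI allI impI)
  have h: "h \<in> ring_hom R S" "bij_betw h (carrier R) (carrier S)"
    using assms(3) by (auto simp: ring_iso_def)
  show "primeideal {r \<in> carrier R. h r \<in> P i} R" if "i \<le> n" for i
    using primeideal_vimage[OF assms(1,2) h(1)] assms(4) that by (simp add: prime_chain_def)
  fix i assume i: "i < n"
  then have sub: "P i \<subset> P (Suc i)" and "primeideal (P (Suc i)) S"
    using assms(4) by (auto simp: prime_chain_def)
  then have "P (Suc i) \<subseteq> carrier S"
    by (meson additive_subgroup.a_subset ideal.axioms(1) primeideal.axioms(1))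
  moreover obtain s where s: "s \<in> P (Suc i)" "s \<notin> P i" using sub by auto
  ultimately obtain r where "r \<in> carrier R" "h r = s"
    using h(2) by (metis bij_betw_def imageE subsetD)
  then show "{r \<in> carrier R. h r \<in> P i} \<subset> {r \<in> carrier R. h r \<in> P (Suc i)}"
    using sub s by blast
qed

lemma krull_dim_prime_chain: "krull_dim R = Sup {enat n | n. \<exists>P. prime_chain R n P}"
  by (simp add: krull_dim_def prime_chain_def)

lemma krull_dim_iso:
  assumes "cring R" "cring S" "h \<in> ring_iso R S"
  shows "krull_dim R = krull_dim S"
proof -
  have "inv_into (carrier R) h \<in> ring_iso S R"
    using ring_iso_set_sym[OF _ assms(3)] assms(1) cring.axioms(1) by blast
  then have "(\<exists>P. prime_chain R n P) \<longleftrightarrow> (\<exists>P. prime_chain S n P)" for n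
    using prime_chain_vimage[OF assms, of n] prime_chain_vimage[OF assms(2,1), of _ n] by blast
  then show ?thesis by (simp add: krull_dim_prime_chain)
qed

lemma krull_dim_eqI:
  assumes "prime_chain R n P" "\<And>m Q. prime_chain R m Q \<Longrightarrow> m \<le> n"
  shows "krull_dim R = enat n"
  unfolding krull_dim_prime_chain
  by (rule antisym) (use assms in \<open>auto intro!: Sup_least Sup_upper\<close>)

text \<open>
  The target is an integral domain because its exponents form a linearly ordered monoid.
\<close>

lemma primeideal_kernel_push:
  fixes d :: "'a::comm_monoid_add \<Rightarrow> 'b::{ordered_cancel_comm_monoid_add, linorder}"
  assumes "additive_submonoid M" "\<And>m m'. d (m + m') = d m + d m'" "d 0 = 0"
  shows "primeideal {p. keys p \<subseteq> M \<and> push d p = 0} (monoid_algebra M :: ('a \<Rightarrow>\<^sub>0 'k::field) ring)"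
proof -
  let ?B = "monoid_algebra UNIV :: ('b \<Rightarrow>\<^sub>0 'k) ring"
  have M: "cring (monoid_algebra M :: ('a \<Rightarrow>\<^sub>0 'k) ring)" by (rule monoid_algebra_cring) fact
  have B: "cring ?B" by (rule monoid_algebra_cring) (simp add: additive_submonoid_def)
  then have "domain ?B" by (intro domain.intro domain_axioms.intro) auto
  then have "primeideal {\<zero>\<^bsub>?B\<^esub>} ?B" by (rule domain.zeroprimeideal)
  moreover have "push d \<in> ring_hom (monoid_algebra M) ?B" by (rule push_ring_hom) (use assms in auto)
  ultimately have "primeideal {p \<in> carrier (monoid_algebra M). push d p \<in> {\<zero>\<^bsub>?B\<^esub>}} (monoid_algebra M)"
    by (intro primeideal_vimage[OF M B])
  then show ?thesis by simp
qed

section \<open>Toric rings as monoid algebras\<close>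

definition deg_vec :: "('v, 'e) graph \<Rightarrow> ('e \<Rightarrow>\<^sub>0 nat) \<Rightarrow> ('v \<Rightarrow>\<^sub>0 nat)" where
  "deg_vec G m = (\<Sum>e\<in>keys m. \<Sum>v\<in>ends G e. single v (lookup m e))"

lemma deg_vec_add: "deg_vec G (m + m') = deg_vec G m + deg_vec G m'"
  unfolding deg_vec_def
  by (rule setsum_keys_plus_distrib) (simp_all add: single_add sum.distrib)

lemma deg_vec_zero [simp]: "deg_vec G 0 = 0"
  by (simp add: deg_vec_def)

lemma prod_single_one: "(\<Prod>v\<in>A. single (f v) (1::'k::field)) = single (\<Sum>v\<in>A. f v) 1"
  by (induction A rule: infinite_finite_induct) (simp_all add: mult_single)

lemma single_var_power: "single (single v (1::nat)) (1::'k::field) ^ n = single (single v n) 1"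
  by (induction n) (simp_all add: mult_single single_add[symmetric])

text \<open>
  The toric map sends monomials to monomials, so it is determined by the map \<open>deg_vec G\<close> of exponents.
\<close>

lemma toric_map_eq_push: "(toric_map G :: ('e, 'k::field) mpoly \<Rightarrow> ('v, 'k) mpoly) = push (deg_vec G)"
proof
  fix p :: "('e, 'k) mpoly"
  show "toric_map G p = push (deg_vec G) p"
    unfolding toric_map_def mpoly_subst_def push_def mpoly_const_def mpoly_var_def
    by (simp add: prod_power_distrib single_var_power[unfolded One_nat_def])
       (simp add: prod_single_one mult_single deg_vec_def)
qed

lemma mpoly_ring_eq: "mpoly_ring X = monoid_algebra {m. keys m \<subseteq> X}"
  by (auto simp: mpoly_ring_def monoid_algebra_def)

lemma submonoid_keys: "additive_submonoid {m::'a \<Rightarrow>\<^sub>0 nat. keys m \<subseteq> X}"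
  using keys_add by (fastforce simp: additive_submonoid_def)

text \<open>
  The affine monoid generated by the edges; the toric ring is its monoid algebra.
\<close>

definition edge_monoid :: "('v, 'e) graph \<Rightarrow> ('v \<Rightarrow>\<^sub>0 nat) set" where
  "edge_monoid G = deg_vec G ` {m. keys m \<subseteq> edges G}"

lemma submonoid_edge_monoid: "additive_submonoid (edge_monoid G)"
  unfolding additive_submonoid_def edge_monoid_def
proof (intro conjI ballI)
  show "0 \<in> deg_vec G ` {m. keys m \<subseteq> edges G}" by (rule image_eqI[of _ _ 0]) auto
  fix a b assume "a \<in> deg_vec G ` {m. keys m \<subseteq> edges G}" "b \<in> deg_vec G ` {m. keys m \<subseteq> edges G}"
  then obtain m m' where "a = deg_vec G m" "b = deg_vec G m'" "keys m \<subseteq> edges G" "keys m' \<subseteq> edges G"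
    by auto
  then show "a + b \<in> deg_vec G ` {m. keys m \<subseteq> edges G}"
    using keys_add[of m m'] by (intro image_eqI[of _ _ "m + m'"]) (auto simp: deg_vec_add)
qed

text \<open>
  The first isomorphism theorem for the toric map. The isomorphism comes with its values, because
  the scalars and the graded components have to be carried along it.
\<close>

lemma toric_ring_iso:
  fixes G :: "('v, 'e) graph"
  defines "S \<equiv> mpoly_ring (edges G) :: ('e, 'k::field) mpoly ring"
  defines "A \<equiv> monoid_algebra (edge_monoid G) :: ('v, 'k) mpoly ring"
  shows "cring (S Quot toric_ideal G) \<and> (\<exists>h. h \<in> ring_iso A (S Quot toric_ideal G) \<and>
    (\<forall>p\<in>carrier S. h (push (deg_vec G) p) = toric_ideal G +>\<^bsub>S\<^esub> p))"
proof -
  let ?f = "push (deg_vec G) :: ('e, 'k) mpoly \<Rightarrow> ('v, 'k) mpoly"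
  have S: "cring S" unfolding S_def mpoly_ring_eq by (intro monoid_algebra_cring submonoid_keys)
  have A: "cring A" unfolding A_def by (intro monoid_algebra_cring submonoid_edge_monoid)
  interpret f: ring_hom_ring S A ?f
  proof (rule ring_hom_ringI2[OF cring.axioms(1)[OF S] cring.axioms(1)[OF A]])
    show "?f \<in> ring_hom S A" unfolding S_def A_def mpoly_ring_eq edge_monoid_def
      by (rule push_ring_hom) (auto simp: deg_vec_add)
  qed
  have I: "toric_ideal G = a_kernel S A ?f"
    unfolding toric_ideal_def a_kernel_def' toric_map_eq_push S_def A_def mpoly_ring_eq
      monoid_algebra_simps ..
  have surj: "?f ` carrier S = carrier A"
  proof
    show "carrier A \<subseteq> ?f ` carrier S"
    proof
      fix q assume "q \<in> carrier A"
      then have "keys q \<subseteq> deg_vec G ` {m. keys m \<subseteq> edges G}" by (simp add: A_def edge_monoid_def)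
      then obtain p where "keys p \<subseteq> {m. keys m \<subseteq> edges G}" "?f p = q" using push_surj by blast
      then show "q \<in> ?f ` carrier S" by (auto simp: S_def mpoly_ring_eq)
    qed
  qed auto
  let ?g = "\<lambda>X. the_elem (?f ` X)"
  let ?Q = "S Quot toric_ideal G"
  have g: "?g \<in> ring_iso ?Q A" unfolding I by (rule f.FactRing_iso_set) (rule surj)
  have "ideal (toric_ideal G) S" unfolding I by (rule f.kernel_is_ideal)
  then have Q: "cring ?Q" by (rule ideal.quotient_is_cring) (rule S)
  have "inv_into (carrier ?Q) ?g \<in> ring_iso A ?Q"
    using Q by (intro ring_iso_set_sym g) (rule cring.axioms(1))
  moreover have "inv_into (carrier ?Q) ?g (?f p) = toric_ideal G +>\<^bsub>S\<^esub> p" if "p \<in> carrier S" for p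
  proof (rule inv_into_f_eq)
    show "inj_on ?g (carrier ?Q)" using g by (simp add: ring_iso_def bij_betw_def)
    show "toric_ideal G +>\<^bsub>S\<^esub> p \<in> carrier ?Q"
      using that ring_hom_closed[OF ideal.rcos_ring_hom[OF \<open>ideal (toric_ideal G) S\<close>]] by auto
    show "?g (toric_ideal G +>\<^bsub>S\<^esub> p) = ?f p" unfolding I using that by simp
  qed
  ultimately show ?thesis using Q by blast
qed

lemma krull_dim_toric_ring:
  fixes G :: "('v, 'e) graph"
  shows "krull_dim (alg_ring (toric_ring G :: ('e, 'k::field) mpoly set graded_algebra)) =
   krull_dim (monoid_algebra (edge_monoid G) :: ('v, 'k) mpoly ring)"
proof -
  let ?S = "mpoly_ring (edges G) :: ('e, 'k) mpoly ring"
  let ?A = "monoid_algebra (edge_monoid G) :: ('v, 'k) mpoly ring"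
  let ?I = "toric_ideal G :: ('e, 'k) mpoly set"
  have Q: "cring (?S Quot ?I)" and "\<exists>h. h \<in> ring_iso ?A (?S Quot ?I)"
    using toric_ring_iso[where 'k='k and G=G] by blast+
  then obtain h where h: "h \<in> ring_iso ?A (?S Quot ?I)" by blast
  have "krull_dim ?A = krull_dim (?S Quot ?I)"
    by (rule krull_dim_iso[OF monoid_algebra_cring[OF submonoid_edge_monoid] Q h])
  then show ?thesis by (simp add: toric_ring_def Let_def)
qed

section \<open>The Hilbert function of a toric ring\<close>

definition constant_polys :: "('a::comm_monoid_add \<Rightarrow>\<^sub>0 'k::field) set" where
  "constant_polys = range (single 0)"

lemma subfield_constant_polys:
  assumes "additive_submonoid M"
  shows "subfield (constant_polys :: ('a::comm_monoid_add \<Rightarrow>\<^sub>0 'k::field) set) (monoid_algebra M)"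
proof -
  interpret A: cring "monoid_algebra M :: ('a \<Rightarrow>\<^sub>0 'k) ring" by (rule monoid_algebra_cring) fact
  have eq: "(constant_polys :: ('a \<Rightarrow>\<^sub>0 'k) set) = {p. keys p \<subseteq> {0}}"
  proof -
    have "p \<in> constant_polys" if "keys p \<subseteq> {0}" for p :: "'a \<Rightarrow>\<^sub>0 'k"
    proof -
      have "p = single 0 (lookup p 0)"
        using that by (intro poly_mapping_eqI) (auto simp: lookup_single when_def in_keys_iff)
      then show ?thesis unfolding constant_polys_def by blast
    qed
    then show ?thesis by (auto simp: constant_polys_def split: if_splits)
  qed
  have e: "monoid_algebra M\<lparr>carrier := constant_polys\<rparr> = (monoid_algebra {0} :: ('a \<Rightarrow>\<^sub>0 'k) ring)"
    by (simp add: monoid_algebra_def eq)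
  interpret K: cring "monoid_algebra {0} :: ('a \<Rightarrow>\<^sub>0 'k) ring"
    by (rule monoid_algebra_cring) (simp add: additive_submonoid_def)
  have "field (monoid_algebra {0} :: ('a \<Rightarrow>\<^sub>0 'k) ring)"
  proof (rule K.cring_fieldI2)
    fix a :: "'a \<Rightarrow>\<^sub>0 'k"
    assume "a \<in> carrier (monoid_algebra {0})" and nz: "a \<noteq> \<zero>\<^bsub>monoid_algebra {0}\<^esub>"
    then have "a \<in> constant_polys" by (simp add: eq)
    then obtain c where "a = single 0 c" by (auto simp: constant_polys_def)
    moreover from this have "c \<noteq> 0" using nz by auto
    ultimately show "\<exists>b\<in>carrier (monoid_algebra {0}). a \<otimes>\<^bsub>monoid_algebra {0}\<^esub> b = \<one>\<^bsub>monoid_algebra {0}\<^esub>"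
      by (intro bexI[of _ "single 0 (inverse c)"]) (auto simp: mult_single)
  qed simp
  then have "field (monoid_algebra M\<lparr>carrier := constant_polys\<rparr> :: ('a \<Rightarrow>\<^sub>0 'k) ring)" by (simp only: e)
  moreover have "constant_polys \<subseteq> carrier (monoid_algebra M :: ('a \<Rightarrow>\<^sub>0 'k) ring)"
    using assms by (auto simp: eq additive_submonoid_def)
  ultimately show ?thesis by (rule A.subfield_iff(1))
qed

text \<open>
  The monomials with exponent in \<open>T\<close> form a basis. Adding them one at a time matches the inductive definition of
  dimension by line extensions.
\<close>

lemma dimension_keys:
  assumes "additive_submonoid M" "finite T" "T \<subseteq> M"
  shows "ring.dimension (monoid_algebra M :: ('a::comm_monoid_add \<Rightarrow>\<^sub>0 'k::field) ring)
    (card T) constant_polys {p. keys p \<subseteq> T}"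
  using assms(2,3)
proof (induction T)
  interpret A: cring "monoid_algebra M :: ('a \<Rightarrow>\<^sub>0 'k) ring" by (rule monoid_algebra_cring) fact
  {
    case empty
    have "{p :: 'a \<Rightarrow>\<^sub>0 'k. keys p \<subseteq> {}} = {0}" by auto
    then show ?case using A.zero_dim by simp
  next
    case (insert a T)
    let ?E = "{p :: 'a \<Rightarrow>\<^sub>0 'k. keys p \<subseteq> T}"
    have "A.dimension (Suc (card T)) constant_polys (A.line_extension constant_polys (single a 1) ?E)"
      using insert by (intro A.Suc_dim) auto
    moreover have "A.line_extension constant_polys (single a 1) ?E = {p. keys p \<subseteq> insert a T}"
    proof (intro subset_antisym subsetI)
      fix u :: "'a \<Rightarrow>\<^sub>0 'k"
      assume "u \<in> A.line_extension constant_polys (single a 1) ?E"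
      then obtain c v where "u = single a c + v" "keys v \<subseteq> T"
        by (auto simp: A.line_extension_mem_iff constant_polys_def mult_single)
      then show "u \<in> {p. keys p \<subseteq> insert a T}" using keys_add[of "single a c" v] by (auto split: if_splits)
    next
      fix u :: "'a \<Rightarrow>\<^sub>0 'k"
      assume u: "u \<in> {p. keys p \<subseteq> insert a T}"
      have "keys (u - single a (lookup u a)) \<subseteq> T"
        using u by (auto simp: in_keys_iff lookup_minus lookup_single when_def subset_iff split: if_splits)
      moreover have "u = single 0 (lookup u a) * single a 1 + (u - single a (lookup u a))"
        by (simp add: mult_single)
      ultimately show "u \<in> A.line_extension constant_polys (single a 1) ?E"
        unfolding A.line_extension_mem_iff constant_polys_def monoid_algebra_simps by blast
    qed
    ultimately show ?case using insert by simp
  }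
qed

definition mdeg :: "('e \<Rightarrow>\<^sub>0 nat) \<Rightarrow> nat" where
  "mdeg m = (\<Sum>x\<in>keys m. lookup m x)"

lemma mdeg_zero [simp]: "mdeg 0 = 0"
  by (simp add: mdeg_def)

lemma mdeg_add: "mdeg (m + m') = mdeg m + mdeg m'"
  unfolding mdeg_def by (rule setsum_keys_plus_distrib) simp_all

text \<open>
  Under the isomorphism with the monoid algebra, the component of degree \<open>d\<close> becomes the span of the
  monomials whose exponents are the degree vectors of the monomials of degree \<open>d\<close> in the edges.
\<close>

lemma hilbert_function_toric_ring:
  fixes G :: "('v, 'e) graph" and d :: nat
  defines "T \<equiv> deg_vec G ` {m. keys m \<subseteq> edges G \<and> mdeg m = d}"
  assumes fin: "finite T"
  shows "hilbert_function (toric_ring G :: ('e, 'k::field) mpoly set graded_algebra) d = card T"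
proof -
  let ?S = "mpoly_ring (edges G) :: ('e, 'k) mpoly ring"
  let ?A = "monoid_algebra (edge_monoid G) :: ('v, 'k) mpoly ring"
  let ?I = "toric_ideal G :: ('e, 'k) mpoly set"
  let ?f = "push (deg_vec G) :: ('e, 'k) mpoly \<Rightarrow> ('v, 'k) mpoly"
  have sm: "additive_submonoid (edge_monoid G)" by (rule submonoid_edge_monoid)
  interpret A: cring ?A by (rule monoid_algebra_cring) (rule sm)
  have Q: "cring (?S Quot ?I)" and "\<exists>h. h \<in> ring_iso ?A (?S Quot ?I) \<and>
    (\<forall>p\<in>carrier ?S. h (?f p) = ?I +>\<^bsub>?S\<^esub> p)"
    using toric_ring_iso[where 'k='k and G=G] by blast+
  then obtain h where h: "h \<in> ring_iso ?A (?S Quot ?I)"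
    "\<And>p. p \<in> carrier ?S \<Longrightarrow> h (?f p) = ?I +>\<^bsub>?S\<^esub> p" by blast
  interpret Q: cring "?S Quot ?I" by (rule Q)
  interpret h: ring_hom_ring ?A "?S Quot ?I" h
    by (rule ring_hom_ringI2) (use h(1) in \<open>simp_all add: A.ring_axioms Q.ring_axioms ring_iso_def\<close>)
  have inj: "inj_on h (carrier ?A)" using h(1) by (simp add: ring_iso_def bij_betw_def)
  have "h \<one>\<^bsub>?A\<^esub> \<noteq> h \<zero>\<^bsub>?A\<^esub>"
    using inj_on_eq_iff[OF inj A.one_closed A.zero_closed] by simp
  then have oz: "\<one>\<^bsub>?S Quot ?I\<^esub> \<noteq> \<zero>\<^bsub>?S Quot ?I\<^esub>" by (simp only: h.hom_one h.hom_zero) simp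
  have T: "T \<subseteq> edge_monoid G" by (auto simp: edge_monoid_def T_def)
  note K = subfield_constant_polys[OF sm, where 'k='k]
  have "Q.dimension (card T) (h ` constant_polys) (h ` {p. keys p \<subseteq> T})"
    by (rule h.inj_hom_dimension[OF K oz _ dimension_keys[OF sm fin T]])
       (rule inj_on_subset[OF inj], use T in auto)
  then have dim: "Q.dim (h ` constant_polys) (h ` {p. keys p \<subseteq> T}) = card T"
    using Q.dimI[OF h.img_is_subfield(2)[OF K oz]] by (simp add: over_def)
  have "h ` constant_polys = {?I +>\<^bsub>?S\<^esub> mpoly_const c | c. True}"
  proof -
    have "h (single 0 c) = ?I +>\<^bsub>?S\<^esub> mpoly_const c" for c
      using h(2)[of "mpoly_const c"] by (simp add: mpoly_const_def mpoly_ring_eq)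
    then show ?thesis by (auto simp: constant_polys_def)
  qed
  moreover have "h ` {p. keys p \<subseteq> T} = {?I +>\<^bsub>?S\<^esub> p | p. p \<in> carrier ?S \<and> homogeneous d p}"
  proof -
    have hom: "p \<in> carrier ?S \<and> homogeneous d p \<longleftrightarrow> keys p \<subseteq> {m. keys m \<subseteq> edges G \<and> mdeg m = d}" for p :: "('e, 'k) mpoly"
      by (auto simp: mpoly_ring_eq homogeneous_def mdeg_def)
    have "{p. keys p \<subseteq> T} = ?f ` {p. keys p \<subseteq> {m. keys m \<subseteq> edges G \<and> mdeg m = d}}"
    proof
      show "{p. keys p \<subseteq> T} \<subseteq> ?f ` {p. keys p \<subseteq> {m. keys m \<subseteq> edges G \<and> mdeg m = d}}"
        using push_surj[of _ "deg_vec G" "{m. keys m \<subseteq> edges G \<and> mdeg m = d}"] unfolding T_def by blast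
      show "?f ` {p. keys p \<subseteq> {m. keys m \<subseteq> edges G \<and> mdeg m = d}} \<subseteq> {p. keys p \<subseteq> T}"
      proof (rule image_subsetI)
        fix p :: "('e, 'k) mpoly" assume "p \<in> {p. keys p \<subseteq> {m. keys m \<subseteq> edges G \<and> mdeg m = d}}"
        then have "deg_vec G ` keys p \<subseteq> T" unfolding T_def by (intro image_mono) simp
        then show "?f p \<in> {p. keys p \<subseteq> T}" using order_trans[OF keys_push[of "deg_vec G" p]] by simp
      qed
    qed
    then have "h ` {p. keys p \<subseteq> T} = (\<lambda>p. h (?f p)) ` {p. p \<in> carrier ?S \<and> homogeneous d p}"
      by (simp add: hom image_image)
    also have "\<dots> = (\<lambda>p. ?I +>\<^bsub>?S\<^esub> p) ` {p. p \<in> carrier ?S \<and> homogeneous d p}"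
      by (rule image_cong) (auto simp: h(2))
    finally show ?thesis by auto
  qed
  ultimately show ?thesis using dim
    by (simp add: hilbert_function_def toric_ring_def Let_def)
qed

section \<open>Growth bounds the length of chains of prime ideals\<close>

lemma primeideal_monoid_algebraD:
  assumes "primeideal P (monoid_algebra M :: ('a::comm_monoid_add \<Rightarrow>\<^sub>0 'k::field) ring)"
  shows "p \<in> P \<Longrightarrow> q \<in> P \<Longrightarrow> p - q \<in> P"
    and "p \<in> P \<Longrightarrow> keys q \<subseteq> M \<Longrightarrow> q * p \<in> P"
    and "keys p \<subseteq> M \<Longrightarrow> keys q \<subseteq> M \<Longrightarrow> p * q \<in> P \<Longrightarrow> p \<in> P \<or> q \<in> P"
    and "p \<in> P \<Longrightarrow> keys p \<subseteq> M" and "0 \<in> P" and "0 \<in> M" and "1 \<notin> P"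
proof -
  interpret primeideal P "monoid_algebra M :: ('a \<Rightarrow>\<^sub>0 'k) ring" by fact
  have "\<zero>\<^bsub>monoid_algebra M :: ('a \<Rightarrow>\<^sub>0 'k) ring\<^esub> \<in> P"
    by (rule additive_subgroup.zero_closed[OF is_additive_subgroup])
  then show z: "0 \<in> P" by simp
  show M: "0 \<in> M" using one_closed by simp
  show sub: "p \<in> P \<Longrightarrow> keys p \<subseteq> M" for p using a_subset by auto
  show "1 \<notin> P" using I_notcarr one_imp_carrier by auto
  show mult: "p \<in> P \<Longrightarrow> keys q \<subseteq> M \<Longrightarrow> q * p \<in> P" for p q using I_l_closed by simp
  show "keys p \<subseteq> M \<Longrightarrow> keys q \<subseteq> M \<Longrightarrow> p * q \<in> P \<Longrightarrow> p \<in> P \<or> q \<in> P"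
    using I_prime by simp
  show "p - q \<in> P" if "p \<in> P" "q \<in> P"
  proof -
    have "single 0 (- 1) * q = - q" by (simp add: single_uminus)
    then have "- q \<in> P" using mult[OF that(2), of "single 0 (- 1)"] M by auto
    then show ?thesis using additive_subgroup.a_closed[OF is_additive_subgroup that(1)] by fastforce
  qed
qed

lemma keys_power_sub:
  assumes "additive_submonoid M" "keys p \<subseteq> M" shows "keys (p ^ n) \<subseteq> M"
proof (induction n)
  case 0
  then show ?case using assms(1) by (simp add: additive_submonoid_def)
next
  case (Suc n)
  then show ?case using keys_mult_sub[OF assms] by simp
qed

lemma keys_sum_sub: "(\<And>i. i \<in> I \<Longrightarrow> keys (f i) \<subseteq> M) \<Longrightarrow> keys (\<Sum>i\<in>I. f i) \<subseteq> M"
proof (induction I rule: infinite_finite_induct)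
  case (insert i I)
  then show ?case using keys_add[of "f i" "sum f I"] by auto
qed auto

text \<open>
  An element of \<open>Q - P\<close> is transcendental modulo \<open>P\<close> over any family that is independent modulo \<open>Q\<close>: in
  the use below, each \<open>S x\<close> is a linear combination of such a family, hence zero once it lies in \<open>Q\<close>.
\<close>

lemma independent_powers_mod_prime:
  fixes f :: "'a::comm_monoid_add \<Rightarrow>\<^sub>0 'k::field" and S :: "nat \<Rightarrow> 'a \<Rightarrow>\<^sub>0 'k"
  assumes M: "additive_submonoid M"
    and P: "primeideal P (monoid_algebra M)" and Q: "primeideal Q (monoid_algebra M)"
    and "P \<subseteq> Q" "f \<in> Q" "f \<notin> P"
    and "\<And>x. keys (S x) \<subseteq> M" "\<And>x. x \<le> d \<Longrightarrow> S x \<in> Q \<Longrightarrow> S x = 0"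
    and "(\<Sum>x\<le>d. f ^ x * S x) \<in> P"
  shows "\<forall>x\<le>d. S x = 0"
  using assms(7-)
proof (induction d arbitrary: S)
  case 0
  then show ?case using \<open>P \<subseteq> Q\<close> by auto
next
  case (Suc d)
  let ?T = "\<Sum>x\<le>d. f ^ x * S (Suc x)"
  have f: "keys f \<subseteq> M" using primeideal_monoid_algebraD(4)[OF Q] \<open>f \<in> Q\<close> by blast
  have T: "keys ?T \<subseteq> M"
    by (intro keys_sum_sub keys_mult_sub[OF M] keys_power_sub[OF M] f Suc.prems)
  have eq: "(\<Sum>x\<le>Suc d. f ^ x * S x) = S 0 + f * ?T"
    by (simp only: sum.atMost_Suc_shift) (simp add: sum_distrib_left mult.assoc)
  \<comment> \<open>Modulo \<open>Q\<close> only the term with \<open>x = 0\<close> survives, so it vanishes; then \<open>f\<close> can be cancelled modulo \<open>P\<close>.\<close>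
  have "?T * f \<in> Q" using primeideal_monoid_algebraD(2)[OF Q \<open>f \<in> Q\<close> T] .
  moreover have "S 0 + f * ?T \<in> Q" using Suc.prems(3) \<open>P \<subseteq> Q\<close> unfolding eq by blast
  ultimately have "S 0 \<in> Q"
    using primeideal_monoid_algebraD(1)[OF Q, of "S 0 + f * ?T" "?T * f"] by (simp add: mult.commute)
  then have S0: "S 0 = 0" using Suc.prems by blast
  then have "f * ?T \<in> P" using Suc.prems(3) eq by simp
  then have "?T \<in> P" using primeideal_monoid_algebraD(3)[OF P f T] \<open>f \<notin> P\<close> by blast
  then have "\<forall>x\<le>d. S (Suc x) = 0" using Suc.prems by (intro Suc.IH) auto
  then show ?case using S0 by (metis Suc_le_mono old.nat.exhaust)
qed

text \<open>
  The monomial with exponents \<open>xs\<close> in \<open>f 0, f 1, \<dots>\<close>; the recursion shifts \<open>f\<close> so that it follows an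
  induction on the chain of primes from below.
\<close>

fun chain_monomial :: "(nat \<Rightarrow> 'r::comm_monoid_mult) \<Rightarrow> nat list \<Rightarrow> 'r" where
  "chain_monomial f [] = 1"
| "chain_monomial f (x # xs) = f 0 ^ x * chain_monomial (f \<circ> Suc) xs"

definition box :: "nat \<Rightarrow> nat \<Rightarrow> nat list set" where
  "box d n = {xs. set xs \<subseteq> {..d} \<and> length xs = n}"

lemma finite_box [simp]: "finite (box d n)" and card_box: "card (box d n) = Suc d ^ n"
  by (simp_all add: box_def finite_lists_length_eq card_lists_length_eq)

lemma box_0 [simp]: "box d 0 = {[]}"
  by (auto simp: box_def)

lemma sum_box_Suc: "(\<Sum>xs\<in>box d (Suc n). g xs) = (\<Sum>x\<le>d. \<Sum>xs\<in>box d n. g (x # xs))"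
proof -
  have "bij_betw (\<lambda>(x, xs). x # xs) ({..d} \<times> box d n) (box d (Suc n))"
    by (auto simp: bij_betw_def inj_on_def box_def length_Suc_conv image_iff)
  then have "(\<Sum>xs\<in>box d (Suc n). g xs) = (\<Sum>(x, xs)\<in>{..d} \<times> box d n. g (x # xs))"
    by (auto simp: case_prod_unfold dest: sum.reindex_bij_betw[symmetric, of _ _ _ g])
  then show ?thesis by (simp add: sum.cartesian_product)
qed

lemma keys_chain_monomial:
  assumes "additive_submonoid M" "\<And>j. j < length xs \<Longrightarrow> keys (f j) \<subseteq> M"
  shows "keys (chain_monomial f xs) \<subseteq> M"
  using assms(2)
proof (induction xs arbitrary: f)
  case Nil
  then show ?case using assms(1) by (simp add: additive_submonoid_def)
next
  case (Cons x xs)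
  then show ?case
    unfolding chain_monomial.simps
    by (intro keys_mult_sub[OF assms(1)] keys_power_sub[OF assms(1)] Cons.IH) auto
qed

text \<open>
  Elements \<open>f 0, \<dots>, f (n - 1)\<close> taken from the successive steps of a chain of primes are algebraically
  independent modulo its smallest member. By induction, the monomials in \<open>f 1, f 2, \<dots>\<close> are independent modulo
  \<open>P 1\<close>, and the powers of \<open>f 0\<close> are added with \<open>independent_powers_mod_prime\<close>.
\<close>

lemma chain_monomials_independent:
  fixes f :: "nat \<Rightarrow> 'a::comm_monoid_add \<Rightarrow>\<^sub>0 'k::field" and c :: "nat list \<Rightarrow> 'k"
  assumes M: "additive_submonoid M"
    and "prime_chain (monoid_algebra M) n P" "\<And>j. j < n \<Longrightarrow> f j \<in> P (Suc j) - P j"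
    and "(\<Sum>xs\<in>box d n. single 0 (c xs) * chain_monomial f xs) \<in> P 0"
  shows "\<forall>xs\<in>box d n. c xs = 0"
  using assms(2-)
proof (induction n arbitrary: P f c)
  case 0
  have P: "primeideal (P 0) (monoid_algebra M)" using 0 by (simp add: prime_chain_def)
  show ?case
  proof (rule ccontr)
    assume "\<not> ?case"
    then have c: "c [] \<noteq> 0" by simp
    have "single 0 (inverse (c [])) * single 0 (c []) \<in> P 0"
      using 0 primeideal_monoid_algebraD(2)[OF P, of _ "single 0 (inverse (c []))"]
        primeideal_monoid_algebraD(6)[OF P] by (auto split: if_splits)
    then show False using c primeideal_monoid_algebraD(7)[OF P] by (simp add: mult_single)
  qed
next
  case (Suc n)
  have P: "primeideal (P i) (monoid_algebra M)" if "i \<le> Suc n" for i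
    using Suc.prems(1) that by (simp add: prime_chain_def)
  have f: "keys (f j) \<subseteq> M" if "j < Suc n" for j
    using Suc.prems(2)[OF that] primeideal_monoid_algebraD(4)[OF P[of "Suc j"]] that by auto
  define S where "S x = (\<Sum>xs\<in>box d n. single 0 (c (x # xs)) * chain_monomial (f \<circ> Suc) xs)" for x
  have coeffs: "\<forall>xs\<in>box d n. c (x # xs) = 0" if "S x \<in> P 1" for x
  proof (rule Suc.IH[of "P \<circ> Suc" "f \<circ> Suc"])
    show "prime_chain (monoid_algebra M) n (P \<circ> Suc)"
      using Suc.prems(1) by (auto simp: prime_chain_def)
  qed (use Suc.prems(2) that in \<open>auto simp: S_def comp_def\<close>)
  have zero: "S x = 0" if "S x \<in> P 1" for x
    unfolding S_def using coeffs[OF that] by (intro sum.neutral) simp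
  have "(\<Sum>x\<le>d. f 0 ^ x * S x) \<in> P 0"
    using Suc.prems(3) by (simp add: sum_box_Suc S_def sum_distrib_left mult.left_commute)
  moreover have "keys (S x) \<subseteq> M" for x
    unfolding S_def
    by (intro keys_sum_sub keys_mult_sub[OF M] keys_chain_monomial[OF M])
       (use f M in \<open>auto simp: box_def additive_submonoid_def split: if_splits\<close>)
  moreover have "P 0 \<subseteq> P 1" using Suc.prems(1) by (auto simp: prime_chain_def)
  ultimately have "\<forall>x\<le>d. S x = 0"
    using Suc.prems(2)[of 0] zero by (intro independent_powers_mod_prime[OF M P[of 0] P[of 1]]) auto
  then have "\<forall>x\<le>d. \<forall>xs\<in>box d n. c (x # xs) = 0"
    using coeffs primeideal_monoid_algebraD(5)[OF P[of 1]] by simp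
  then show ?case by (auto simp: box_def length_Suc_conv)
qed

lemma card_independent_le_card_keys:
  fixes g :: "'i \<Rightarrow> 'a::comm_monoid_add \<Rightarrow>\<^sub>0 'k::field"
  assumes fin: "finite B" "finite T" and keys: "\<And>b. b \<in> B \<Longrightarrow> keys (g b) \<subseteq> T"
    and ind: "\<And>c. (\<Sum>b\<in>B. single 0 (c b) * g b) = 0 \<Longrightarrow> \<forall>b\<in>B. c b = 0"
  shows "card B \<le> card T"
proof -
  interpret V: vector_space "\<lambda>c (p :: 'a \<Rightarrow>\<^sub>0 'k). single 0 c * p"
    by standard (simp_all add: distrib_left distrib_right single_add mult_single mult.assoc[symmetric])
  have inj: "inj_on g B"
  proof (rule inj_onI, rule ccontr)
    fix a b assume ab: "a \<in> B" "b \<in> B" "g a = g b" "a \<noteq> b"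
    define c where "c x = (if x = a then 1 else if x = b then - 1 else (0::'k))" for x
    have "(\<Sum>x\<in>B. single 0 (c x) * g x) = (\<Sum>x\<in>{a, b}. single 0 (c x) * g x)"
      using ab fin by (intro sum.mono_neutral_right) (auto simp: c_def)
    also have "\<dots> = 0" using ab by (simp add: c_def single_uminus)
    finally have "c a = 0" using ind ab by blast
    then show False by (simp add: c_def)
  qed
  have "V.independent (g ` B)"
  proof
    assume "V.dependent (g ` B)"
    then obtain u v where u: "v \<in> g ` B" "u v \<noteq> 0" "(\<Sum>v\<in>g ` B. single 0 (u v) * v) = 0"
      using V.dependent_finite[of "g ` B"] fin by auto
    then have "(\<Sum>b\<in>B. single 0 ((u \<circ> g) b) * g b) = 0" by (simp add: sum.reindex[OF inj])
    from ind[OF this] show False using u by auto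
  qed
  moreover have "g ` B \<subseteq> V.span ((\<lambda>a. single a 1) ` T)"
  proof (rule image_subsetI)
    fix b assume "b \<in> B"
    have "g b = (\<Sum>a\<in>keys (g b). single 0 (lookup (g b) a) * single a 1)"
      by (simp add: mult_single poly_mapping_sum_single)
    also have "\<dots> \<in> V.span ((\<lambda>a. single a 1) ` T)"
      using keys[OF \<open>b \<in> B\<close>] by (intro V.span_sum V.span_scale V.span_base) auto
    finally show "g b \<in> V.span ((\<lambda>a. single a 1) ` T)" .
  qed
  ultimately have "card (g ` B) \<le> card ((\<lambda>a. single a (1::'k)) ` T)"
    using V.independent_span_bound fin by blast
  also have "\<dots> \<le> card T" using fin by (intro card_image_le)
  finally show ?thesis by (simp add: card_image[OF inj])
qed

text \<open>
  If the filtration \<open>F\<close> of the exponents grows at most like a polynomial of degree \<open>r\<close>, a chain of primes has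
  length at most \<open>r\<close>: the \<open>(d + 1) ^ n\<close> monomials in \<open>n\<close> elements from the steps of the chain with
  exponents at most \<open>d\<close> are linearly independent, but their exponents lie in one layer of the filtration with index linear in \<open>d\<close>.
\<close>

lemma prime_chain_length_le:
  fixes F :: "nat \<Rightarrow> 'a::comm_monoid_add set" and P :: "nat \<Rightarrow> ('a \<Rightarrow>\<^sub>0 'k::field) set"
  assumes M: "additive_submonoid M"
    and F0: "0 \<in> F 0" and Fadd: "\<And>i j a b. a \<in> F i \<Longrightarrow> b \<in> F j \<Longrightarrow> a + b \<in> F (i + j)"
    and Fmono: "\<And>i j. i \<le> j \<Longrightarrow> F i \<subseteq> F j" and FM: "M \<subseteq> (\<Union>i. F i)"
    and Ffin: "\<And>i. finite (F i)" and Fcard: "\<And>i. card (F i) \<le> Suc i ^ r"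
    and P: "prime_chain (monoid_algebra M) n P"
  shows "n \<le> r"
proof (rule ccontr)
  assume "\<not> n \<le> r"
  have "\<forall>j<n. \<exists>f. f \<in> P (Suc j) - P j" using P by (auto simp: prime_chain_def)
  then obtain f where f: "\<And>j. j < n \<Longrightarrow> f j \<in> P (Suc j) - P j" by metis
  have Pi: "primeideal (P i) (monoid_algebra M)" if "i \<le> n" for i
    using P that by (simp add: prime_chain_def)
  have fM: "keys (f j) \<subseteq> M" if "j < n" for j
    using f[OF that] primeideal_monoid_algebraD(4)[OF Pi[of "Suc j"]] that by auto
  have "\<forall>a\<in>M. \<exists>l. a \<in> F l" using FM by auto
  then obtain l where l: "\<And>a. a \<in> M \<Longrightarrow> a \<in> F (l a)" by metis
  \<comment> \<open>All exponents of the chosen elements lie in the single layer \<open>F D\<close> of the filtration.\<close>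
  define D where "D = (\<Sum>a\<in>(\<Union>j<n. keys (f j)). l a)"
  have fD: "keys (f j) \<subseteq> F D" if "j < n" for j
  proof
    fix a assume a: "a \<in> keys (f j)"
    then have "l a \<le> D" unfolding D_def using that by (intro member_le_sum) auto
    then show "a \<in> F D" using l fM[OF that] a Fmono by blast
  qed
  have mult: "keys (p * q) \<subseteq> F (i + j)" if "keys p \<subseteq> F i" "keys q \<subseteq> F j" for p q :: "'a \<Rightarrow>\<^sub>0 'k" and i j
    using keys_mult[of p q] that Fadd by blast
  have power: "keys (p ^ x) \<subseteq> F (x * i)" if "keys p \<subseteq> F i" for p :: "'a \<Rightarrow>\<^sub>0 'k" and i x
    using that by (induction x) (simp_all add: F0 mult)
  have mono: "keys (chain_monomial g xs) \<subseteq> F (sum_list xs * D)"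
    if "\<And>j. j < length xs \<Longrightarrow> keys (g j) \<subseteq> F D" for xs and g :: "nat \<Rightarrow> 'a \<Rightarrow>\<^sub>0 'k"
    using that
  proof (induction xs arbitrary: g)
    case (Cons x xs)
    have "keys (g 0 ^ x * chain_monomial (g \<circ> Suc) xs) \<subseteq> F (x * D + sum_list xs * D)"
      using Cons by (intro mult power) auto
    then show ?case by (simp add: distrib_right)
  qed (simp add: F0)
  have bound: "Suc d ^ n \<le> Suc (n * d * D) ^ r" for d
  proof -
    have "card (box d n) \<le> card (F (n * d * D))"
    proof (rule card_independent_le_card_keys)
      fix xs assume xs: "xs \<in> box d n"
      then have "sum_list xs \<le> n * d"
        using sum_list_mono2[of xs "replicate n d"] nth_mem[of _ xs]
        by (auto simp: box_def sum_list_replicate subset_iff simp del: nth_mem)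
      then have "sum_list xs * D \<le> n * d * D" by simp
      moreover have "keys (chain_monomial f xs) \<subseteq> F (sum_list xs * D)"
        using xs fD by (intro mono) (auto simp: box_def)
      ultimately show "keys (chain_monomial f xs) \<subseteq> F (n * d * D)" using Fmono by blast
    next
      fix c :: "nat list \<Rightarrow> 'k"
      assume "(\<Sum>xs\<in>box d n. single 0 (c xs) * chain_monomial f xs) = 0"
      then show "\<forall>xs\<in>box d n. c xs = 0"
        using primeideal_monoid_algebraD(5)[OF Pi[of 0]]
        by (intro chain_monomials_independent[OF M P f]) auto
    qed (auto simp: Ffin)
    then show ?thesis using Fcard[of "n * d * D"] by (simp add: card_box)
  qed
  \<comment> \<open>The left side grows like \<open>d ^ n\<close>, the right side like \<open>C * d ^ r\<close>; \<open>d = C\<close> is already large enough.\<close>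
  define C where "C = Suc (n * D) ^ r"
  have "Suc C ^ Suc r \<le> Suc C ^ n" using \<open>\<not> n \<le> r\<close> by (intro power_increasing) auto
  also have "\<dots> \<le> Suc (n * C * D) ^ r" by (rule bound)
  also have "\<dots> \<le> (Suc (n * D) * Suc C) ^ r" by (intro power_mono) (auto simp: algebra_simps)
  also have "\<dots> = C * Suc C ^ r" by (simp only: power_mult_distrib C_def[symmetric])
  finally show False by simp
qed

section \<open>The dimension of the toric ring of a connected bipartite graph\<close>

text \<open>
  The effect on exponents of setting the variables \<open>vs ! 0, \<dots>, vs ! i\<close> to 1. The remaining variables
  are renamed to their indices in \<open>vs\<close>, because a linear order on the variables is what makes the
  target an integral domain.
\<close>

definition tail_coords :: "'v list \<Rightarrow> nat \<Rightarrow> ('v \<Rightarrow>\<^sub>0 nat) \<Rightarrow> (nat \<Rightarrow>\<^sub>0 nat)" where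
  "tail_coords vs i a = (\<Sum>j\<in>{i<..<length vs}. single j (lookup a (vs ! j)))"

lemma lookup_tail_coords:
  "lookup (tail_coords vs i a) j = (if i < j \<and> j < length vs then lookup a (vs ! j) else 0)"
proof -
  have "lookup (tail_coords vs i a) j = (\<Sum>l\<in>{i<..<length vs}. if l = j then lookup a (vs ! j) else 0)"
    unfolding tail_coords_def lookup_sum by (rule sum.cong) (auto simp: lookup_single when_def)
  then show ?thesis by simp
qed

lemma tail_coords_add: "tail_coords vs i (a + b) = tail_coords vs i a + tail_coords vs i b"
  by (rule poly_mapping_eqI) (simp add: lookup_tail_coords lookup_add)

lemma tail_coords_zero: "tail_coords vs i 0 = 0"
  by (rule poly_mapping_eqI) (simp add: lookup_tail_coords)

lemma tail_coords_Suc: "tail_coords vs (Suc i) = tail_coords [0..<length vs] (Suc i) \<circ> tail_coords vs i"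
  by (rule ext, rule poly_mapping_eqI) (simp add: lookup_tail_coords)

text \<open>
  The kernels of the substitutions that set an initial segment of the vertices to 1. Each vertex after the first is
  joined to an earlier one by an edge \<open>x\<close>, and \<open>x - 1\<close> enters the kernel exactly when that vertex is set to 1.
  The first kernel already has one vertex set to 1, hence one step less than the number of vertices.
\<close>

lemma edge_monoid_prime_chain:
  assumes vs: "distinct vs"
    and edge: "\<And>k. 0 < k \<Longrightarrow> k < length vs \<Longrightarrow> \<exists>j<k. {vs ! j, vs ! k} \<in> ends G ` edges G"
  shows "\<exists>P. prime_chain (monoid_algebra (edge_monoid G) :: ('v, 'k::field) mpoly ring) (length vs - 1) P"
proof -
  let ?M = "edge_monoid G"
  define P where "P i = {p :: ('v, 'k) mpoly. keys p \<subseteq> ?M \<and> push (tail_coords vs i) p = 0}" for i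
  have "P i \<subset> P (Suc i)" if "i < length vs - 1" for i
  proof -
    have i: "Suc i < length vs" using that by simp
    have "P i \<subseteq> P (Suc i)"
    proof
      fix p assume "p \<in> P i"
      moreover have "push (tail_coords vs (Suc i)) p =
          push (tail_coords [0..<length vs] (Suc i)) (push (tail_coords vs i) p)"
        unfolding push_push by (subst tail_coords_Suc) (rule refl)
      ultimately show "p \<in> P (Suc i)" by (simp add: P_def)
    qed
    moreover obtain j e where j: "j \<le> i" "e \<in> edges G" "ends G e = {vs ! j, vs ! Suc i}"
      using edge[of "Suc i"] i by (auto simp: less_Suc_eq_le)
    define x where "x = deg_vec G (single e 1)"
    have ne: "vs ! j \<noteq> vs ! Suc i" using vs i j(1) by (simp add: nth_eq_iff_index_eq)
    have x: "x = single (vs ! j) 1 + single (vs ! Suc i) 1"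
      using ne by (simp add: x_def deg_vec_def j)
    have x_in: "x \<in> ?M" unfolding x_def edge_monoid_def using j(2) by auto
    have at: "lookup x (vs ! l) = (if l = j \<or> l = Suc i then 1 else 0)" if "l < length vs" for l
      using that vs i j(1) by (auto simp: x lookup_add lookup_single when_def nth_eq_iff_index_eq)
    have t: "tail_coords vs i x = single (Suc i) 1"
      by (rule poly_mapping_eqI) (use at i j(1) in \<open>auto simp: lookup_tail_coords lookup_single when_def\<close>)
    have t': "tail_coords vs (Suc i) x = 0"
      by (rule poly_mapping_eqI) (use at i j(1) in \<open>auto simp: lookup_tail_coords\<close>)
    have ne: "single (Suc i) (1::nat) \<noteq> 0"
      by (metis lookup_single_eq lookup_zero zero_neq_one)
    \<comment> \<open>The edge from the next vertex to an earlier one becomes 1 only when that vertex is set to 1.\<close>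
    let ?q = "single x 1 - 1 :: ('v, 'k) mpoly"
    have "keys ?q \<subseteq> ?M"
      using x_in submonoid_edge_monoid[of G]
      by (auto simp: in_keys_iff lookup_minus lookup_single lookup_one when_def additive_submonoid_def split: if_splits)
    then have "?q \<in> P (Suc i)"
      by (simp add: P_def push_minus push_one tail_coords_zero t')
    moreover have "?q \<notin> P i"
    proof
      assume "?q \<in> P i"
      then have "single (single (Suc i) (1::nat)) (1::'k) - 1 = 0"
        by (simp add: P_def push_minus push_one tail_coords_zero t del: One_nat_def)
      then have "lookup (single (single (Suc i) (1::nat)) (1::'k)) 0 = lookup 1 0" by simp
      then show False using ne by (simp add: lookup_single when_def)
    qed
    ultimately show ?thesis by blast
  qed
  moreover have "primeideal (P i) (monoid_algebra ?M)" for i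
    unfolding P_def
    by (rule primeideal_kernel_push) (simp_all add: submonoid_edge_monoid tail_coords_add tail_coords_zero)
  ultimately show ?thesis unfolding prime_chain_def by blast
qed

lemma lookup_deg_vec:
  assumes "\<And>e. e \<in> keys m \<Longrightarrow> finite (ends G e)"
  shows "lookup (deg_vec G m) v = (\<Sum>e\<in>keys m. if v \<in> ends G e then lookup m e else 0)"
  unfolding deg_vec_def lookup_sum
proof (rule sum.cong)
  fix e assume "e \<in> keys m"
  have "(\<Sum>x\<in>ends G e. lookup (single x (lookup m e)) v) = (\<Sum>x\<in>ends G e. if v = x then lookup m e else 0)"
    by (rule sum.cong) (auto simp: lookup_single when_def)
  also have "\<dots> = (if v \<in> ends G e then lookup m e else 0)"
    using assms[OF \<open>e \<in> keys m\<close>] by simp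
  finally show "(\<Sum>x\<in>ends G e. lookup (single x (lookup m e)) v) = (if v \<in> ends G e then lookup m e else 0)" .
qed simp

definition bipartite :: "('v, 'e) graph \<Rightarrow> 'v set \<Rightarrow> 'v set \<Rightarrow> bool" where
  "bipartite G A B \<longleftrightarrow> finite A \<and> finite B \<and> A \<inter> B = {} \<and>
     (\<forall>e\<in>edges G. \<exists>a\<in>A. \<exists>b\<in>B. ends G e = {a, b})"

lemma bipartite_deg_vec:
  assumes G: "bipartite G A B" and m: "keys m \<subseteq> edges G"
  shows "lookup (deg_vec G m) v \<le> mdeg m" "keys (deg_vec G m) \<subseteq> A \<union> B"
    "(\<Sum>v\<in>A. lookup (deg_vec G m) v) = mdeg m" "(\<Sum>v\<in>B. lookup (deg_vec G m) v) = mdeg m"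
proof -
  have e: "\<exists>a\<in>A. \<exists>b\<in>B. ends G e = {a, b}" if "e \<in> keys m" for e
    using G m that unfolding bipartite_def by blast
  have AB: "finite A" "finite B" "A \<inter> B = {}" using G by (auto simp: bipartite_def)
  have look: "lookup (deg_vec G m) v = (\<Sum>e\<in>keys m. if v \<in> ends G e then lookup m e else 0)" for v
    by (rule lookup_deg_vec) (use e in fastforce)
  show "lookup (deg_vec G m) v \<le> mdeg m" unfolding look mdeg_def by (rule sum_mono) simp
  show "keys (deg_vec G m) \<subseteq> A \<union> B"
  proof
    fix v assume "v \<in> keys (deg_vec G m)"
    then have "(\<Sum>e\<in>keys m. if v \<in> ends G e then lookup m e else 0) \<noteq> 0" by (simp add: in_keys_iff look)
    then obtain x where "x \<in> keys m" "(if v \<in> ends G x then lookup m x else 0) \<noteq> 0"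
      by (rule sum.not_neutral_contains_not_neutral)
    then have "x \<in> keys m" "v \<in> ends G x" by (simp_all split: if_splits)
    then show "v \<in> A \<union> B" using e[OF \<open>x \<in> keys m\<close>] by auto
  qed
  have swap: "(\<Sum>v\<in>C. lookup (deg_vec G m) v) = mdeg m"
    if fin: "finite C" and hit: "\<And>e. e \<in> keys m \<Longrightarrow> \<exists>c. C \<inter> ends G e = {c}" for C
  proof -
    have "(\<Sum>v\<in>C. lookup (deg_vec G m) v) = (\<Sum>e\<in>keys m. \<Sum>v\<in>C. if v \<in> ends G e then lookup m e else 0)"
      unfolding look by (rule sum.swap)
    also have "\<dots> = (\<Sum>e\<in>keys m. lookup m e)"
    proof (rule sum.cong)
      fix e assume "e \<in> keys m"
      then obtain c where "C \<inter> ends G e = {c}" using hit by blast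
      then show "(\<Sum>v\<in>C. if v \<in> ends G e then lookup m e else 0) = lookup m e"
        using fin by (simp add: sum.inter_restrict[symmetric])
    qed simp
    finally show ?thesis by (simp add: mdeg_def)
  qed
  show "(\<Sum>v\<in>A. lookup (deg_vec G m) v) = mdeg m"
  proof (rule swap)
    show "\<exists>c. A \<inter> ends G x = {c}" if x: "x \<in> keys m" for x
    proof -
      obtain a b where "a \<in> A" "b \<in> B" "ends G x = {a, b}" using e[OF x] by blast
      then have "A \<inter> ends G x = {a}" using AB(3) by auto
      then show ?thesis ..
    qed
  qed (rule AB)
  show "(\<Sum>v\<in>B. lookup (deg_vec G m) v) = mdeg m"
  proof (rule swap)
    show "\<exists>c. B \<inter> ends G x = {c}" if x: "x \<in> keys m" for x
    proof -
      obtain a b where "a \<in> A" "b \<in> B" "ends G x = {a, b}" using e[OF x] by blast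
      then have "B \<inter> ends G x = {b}" using AB(3) by auto
      then show ?thesis ..
    qed
  qed (rule AB)
qed

definition deg_vecs_upto :: "('v, 'e) graph \<Rightarrow> nat \<Rightarrow> ('v \<Rightarrow>\<^sub>0 nat) set" where
  "deg_vecs_upto G D = deg_vec G ` {m. keys m \<subseteq> edges G \<and> mdeg m \<le> D}"

text \<open>
  The coordinate at \<open>v0\<close> can be recovered from the others, because the coordinates on the two sides of the
  bipartition have the same sum. So these vectors are counted by functions on one vertex less.
\<close>

lemma card_deg_vecs_upto:
  assumes G: "bipartite G A B" and v0: "v0 \<in> A"
  shows "finite (deg_vecs_upto G D) \<and> card (deg_vecs_upto G D) \<le> Suc D ^ (card (A \<union> B) - 1)"
proof -
  let ?X = "A \<union> B - {v0}"
  let ?r = "\<lambda>x :: 'a \<Rightarrow>\<^sub>0 nat. restrict (lookup x) ?X"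
  have AB: "finite A" "finite B" "A \<inter> B = {}" using G by (auto simp: bipartite_def)
  have img: "?r ` deg_vecs_upto G D \<subseteq> (?X \<rightarrow>\<^sub>E {..D})"
  proof (rule image_subsetI)
    fix x assume "x \<in> deg_vecs_upto G D"
    then obtain m where "x = deg_vec G m" "keys m \<subseteq> edges G" "mdeg m \<le> D"
      by (auto simp: deg_vecs_upto_def)
    then have "lookup x v \<le> D" for v using bipartite_deg_vec(1)[OF G, of m v] by simp
    then show "?r x \<in> ?X \<rightarrow>\<^sub>E {..D}" by (simp add: restrict_PiE_iff)
  qed
  have inj: "inj_on ?r (deg_vecs_upto G D)"
  proof (rule inj_onI)
    fix x y assume x: "x \<in> deg_vecs_upto G D" and y: "y \<in> deg_vecs_upto G D" and eq: "?r x = ?r y"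
    have off: "lookup x v = lookup y v" if "v \<in> ?X" for v
      using fun_cong[OF eq, of v] that by simp
    have sums: "(\<Sum>v\<in>A. lookup z v) = (\<Sum>v\<in>B. lookup z v)" "keys z \<subseteq> A \<union> B"
      if "z \<in> deg_vecs_upto G D" for z
      using that bipartite_deg_vec[OF G] by (auto simp: deg_vecs_upto_def)
    have "(\<Sum>v\<in>B. lookup x v) = (\<Sum>v\<in>B. lookup y v)" using off v0 AB(3) by (intro sum.cong) auto
    then have "(\<Sum>v\<in>A. lookup x v) = (\<Sum>v\<in>A. lookup y v)" using sums x y by simp
    moreover have "(\<Sum>v\<in>A - {v0}. lookup x v) = (\<Sum>v\<in>A - {v0}. lookup y v)"
      using off by (intro sum.cong) auto
    ultimately have "lookup x v0 = lookup y v0" using v0 AB(1) by (simp add: sum.remove)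
    then show "x = y"
    proof (intro poly_mapping_eqI)
      fix v
      have "lookup z v = 0" if "v \<notin> A \<union> B" "z \<in> deg_vecs_upto G D" for z
        using sums(2)[OF that(2)] that(1) in_keys_iff[of v z] by blast
      then show "lookup x v = lookup y v"
        using off[of v] \<open>lookup x v0 = lookup y v0\<close> x y by (cases "v \<in> A \<union> B"; cases "v = v0") auto
    qed
  qed
  have fin: "finite (?X \<rightarrow>\<^sub>E {..D})" using AB by (intro finite_PiE) auto
  have "card (deg_vecs_upto G D) \<le> card (?X \<rightarrow>\<^sub>E {..D})" by (rule card_inj_on_le[OF inj img fin])
  also have "\<dots> = Suc D ^ (card (A \<union> B) - 1)" using AB v0 by (simp add: card_PiE)
  finally show ?thesis using inj_on_finite[OF inj img fin] by simp
qed

theorem krull_dim_connected_bipartite: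
  fixes G :: "('v, 'e) graph"
  assumes G: "bipartite G A B" and vs: "distinct vs" "set vs = A \<union> B" "A \<noteq> {}"
    and edge: "\<And>k. 0 < k \<Longrightarrow> k < length vs \<Longrightarrow> \<exists>j<k. {vs ! j, vs ! k} \<in> ends G ` edges G"
  shows "krull_dim (alg_ring (toric_ring G :: ('e, 'k::field) mpoly set graded_algebra)) = enat (length vs - 1)"
proof -
  obtain v0 where v0: "v0 \<in> A" using vs by blast
  have card: "card (A \<union> B) = length vs" using vs distinct_card by metis
  obtain P where P: "prime_chain (monoid_algebra (edge_monoid G) :: ('v, 'k) mpoly ring) (length vs - 1) P"
    using edge_monoid_prime_chain[OF vs(1) edge] by blast
  show ?thesis unfolding krull_dim_toric_ring
  proof (rule krull_dim_eqI[OF P])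
    fix m Q assume Q: "prime_chain (monoid_algebra (edge_monoid G) :: ('v, 'k) mpoly ring) m Q"
    show "m \<le> length vs - 1"
    proof (rule prime_chain_length_le[OF submonoid_edge_monoid _ _ _ _ _ _ Q])
      show "0 \<in> deg_vecs_upto G 0"
        unfolding deg_vecs_upto_def by (rule image_eqI[of _ _ 0]) (auto simp: mdeg_def)
      show "a + b \<in> deg_vecs_upto G (i + j)" if "a \<in> deg_vecs_upto G i" "b \<in> deg_vecs_upto G j" for a b i j
      proof -
        obtain m m' where "a = deg_vec G m" "b = deg_vec G m'" "keys m \<subseteq> edges G" "keys m' \<subseteq> edges G"
          "mdeg m \<le> i" "mdeg m' \<le> j"
          using \<open>a \<in> deg_vecs_upto G i\<close> \<open>b \<in> deg_vecs_upto G j\<close> by (auto simp: deg_vecs_upto_def)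
        then show ?thesis unfolding deg_vecs_upto_def using keys_add[of m m']
          by (intro image_eqI[of _ _ "m + m'"]) (auto simp: deg_vec_add mdeg_add)
      qed
      show "deg_vecs_upto G i \<subseteq> deg_vecs_upto G j" if "i \<le> j" for i j
        using that by (auto simp: deg_vecs_upto_def)
      show "edge_monoid G \<subseteq> (\<Union>i. deg_vecs_upto G i)"
        by (auto simp: edge_monoid_def deg_vecs_upto_def)
    qed (use card_deg_vecs_upto[OF G v0] card in auto)
  qed
qed

section \<open>Hilbert series under addition of a vertex of degree one or two\<close>

(* Below, the multiplicity 1 of an edge is written as it stands, not as Suc 0. *)
declare One_nat_def [simp del]

definition edge_mult :: "nat \<Rightarrow> 'v set \<Rightarrow> ('v \<Rightarrow>\<^sub>0 nat)" where
  "edge_mult i e = (\<Sum>v\<in>e. single v i)"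

lemma edge_mult_add: "edge_mult (i + j) e = edge_mult i e + edge_mult j e"
  by (simp add: edge_mult_def single_add sum.distrib)

lemma edge_mult_Suc: "edge_mult (Suc i) e = edge_mult i e + edge_mult 1 e"
  using edge_mult_add[of i 1 e] by (simp only: Suc_eq_plus1)

lemma edge_mult_0 [simp]: "edge_mult 0 e = 0"
  by (simp add: edge_mult_def)

lemma lookup_edge_mult: "finite e \<Longrightarrow> lookup (edge_mult i e) v = (if v \<in> e then i else 0)"
  by (simp add: edge_mult_def lookup_sum lookup_single when_def)

fun edge_sums :: "'v set set \<Rightarrow> nat \<Rightarrow> ('v \<Rightarrow>\<^sub>0 nat) set" where
  "edge_sums E 0 = {0}"
| "edge_sums E (Suc d) = {a + edge_mult 1 e | a e. a \<in> edge_sums E d \<and> e \<in> E}"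

lemma edge_sums_SucI: "a \<in> edge_sums E d \<Longrightarrow> e \<in> E \<Longrightarrow> a + edge_mult 1 e \<in> edge_sums E (Suc d)"
  by auto

lemma edge_sums_SucE:
  assumes "x \<in> edge_sums E (Suc d)"
  obtains a e where "a \<in> edge_sums E d" "e \<in> E" "x = a + edge_mult 1 e"
  using assms by auto

text \<open>
  Only the set of endpoint sets of a graph matters for its degree vectors, which allows the counting
  below to be done with sets of edges alone.
\<close>

lemma deg_vecs_eq_edge_sums:
  "deg_vec G ` {m. keys m \<subseteq> edges G \<and> mdeg m = d} = edge_sums (ends G ` edges G) d"
proof (induction d)
  case 0
  have "m = 0" if "mdeg m = 0" for m :: "'b \<Rightarrow>\<^sub>0 nat"
    using that by (intro poly_mapping_eqI) (auto simp: mdeg_def in_keys_iff)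
  then have "{m. keys m \<subseteq> edges G \<and> mdeg m = 0} = {0}" by auto
  then show ?case by simp
next
  case (Suc d)
  have single: "deg_vec G (single e 1) = edge_mult 1 (ends G e)" for e
    by (simp add: deg_vec_def edge_mult_def)
  show ?case
  proof (intro subset_antisym subsetI)
    fix x assume "x \<in> deg_vec G ` {m. keys m \<subseteq> edges G \<and> mdeg m = Suc d}"
    then obtain m where m: "x = deg_vec G m" "keys m \<subseteq> edges G" "mdeg m = Suc d" by auto
    then obtain e where e: "e \<in> keys m" by (force simp: mdeg_def)
    define m' where "m' = m - single e 1"
    have eq: "m = m' + single e 1"
      using e by (intro poly_mapping_eqI)
        (auto simp: m'_def lookup_add lookup_minus lookup_single when_def in_keys_iff)
    have "keys m' \<subseteq> edges G"
      using m(2) by (auto simp: m'_def in_keys_iff lookup_minus subset_iff)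
    moreover have "mdeg m' = d" using m(3) mdeg_add[of m' "single e 1"] unfolding eq[symmetric]
      by (simp add: mdeg_def)
    ultimately have "deg_vec G m' \<in> edge_sums (ends G ` edges G) d" unfolding Suc[symmetric] by blast
    moreover have "x = deg_vec G m' + edge_mult 1 (ends G e)"
      using m(1) eq deg_vec_add[of G m' "single e 1"] single by simp
    ultimately show "x \<in> edge_sums (ends G ` edges G) (Suc d)" using e m(2)
      by (simp only:) (rule edge_sums_SucI, auto)
  next
    fix x assume "x \<in> edge_sums (ends G ` edges G) (Suc d)"
    then obtain a f where "a \<in> edge_sums (ends G ` edges G) d" "f \<in> ends G ` edges G" "x = a + edge_mult 1 f"
      by (rule edge_sums_SucE)
    then obtain m e where m: "keys m \<subseteq> edges G" "mdeg m = d" "e \<in> edges G"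
      and x: "x = deg_vec G m + edge_mult 1 (ends G e)"
      unfolding Suc[symmetric] by auto
    have "mdeg (m + single e 1) = Suc d" using m(2) by (simp add: mdeg_add) (simp add: mdeg_def)
    moreover have "keys (m + single e 1) \<subseteq> edges G" using keys_add[of m "single e 1"] m by auto
    ultimately show "x \<in> deg_vec G ` {m. keys m \<subseteq> edges G \<and> mdeg m = Suc d}"
      using x by (intro image_eqI[of _ _ "m + single e 1"]) (simp_all add: deg_vec_add single)
  qed
qed

lemma finite_edge_sums [simp]: "finite E \<Longrightarrow> finite (edge_sums E d)"
proof (induction d)
  case (Suc d)
  have "edge_sums E (Suc d) = (\<lambda>(a, e). a + edge_mult 1 e) ` (edge_sums E d \<times> E)" by auto
  then show ?case using Suc by simp
qed simp

lemma edge_sums_mono: "E \<subseteq> F \<Longrightarrow> edge_sums E d \<subseteq> edge_sums F d"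
  by (induction d) auto

lemma lookup_edge_sums_outside:
  assumes "\<forall>e\<in>E. v \<notin> e" "\<forall>e\<in>E. finite e" "a \<in> edge_sums E d"
  shows "lookup a v = 0"
  using assms(3)
proof (induction d arbitrary: a)
  case (Suc d)
  then show ?case using assms(1,2) by (auto simp: lookup_add lookup_edge_mult)
qed simp

lemma edge_sums_insert:
  "x \<in> edge_sums (insert e E) d \<longleftrightarrow> (\<exists>i k b. i + k = d \<and> b \<in> edge_sums E k \<and> x = edge_mult i e + b)"
proof
  show "\<exists>i k b. i + k = d \<and> b \<in> edge_sums E k \<and> x = edge_mult i e + b"
    if "x \<in> edge_sums (insert e E) d" using that
  proof (induction d arbitrary: x)
    case (Suc d)
    from Suc.prems obtain a f where a: "a \<in> edge_sums (insert e E) d" "f \<in> insert e E" "x = a + edge_mult 1 f"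
      by (rule edge_sums_SucE)
    from Suc.IH[OF a(1)] obtain i k b where *: "i + k = d" "b \<in> edge_sums E k" "a = edge_mult i e + b"
      by blast
    show ?case
    proof (cases "f = e")
      case True
      have "Suc i + k = Suc d" "x = edge_mult (Suc i) e + b"
        using * a(3) True by (simp_all add: edge_mult_Suc add_ac)
      then show ?thesis using *(2) by blast
    next
      case False
      then have "b + edge_mult 1 f \<in> edge_sums E (Suc k)" using *(2) a(2) by (intro edge_sums_SucI) auto
      moreover have "i + Suc k = Suc d" "x = edge_mult i e + (b + edge_mult 1 f)"
        using * a(3) by (simp_all add: add_ac)
      ultimately show ?thesis by blast
    qed
  qed (intro exI[of _ 0], simp)
  have "edge_mult i e + b \<in> edge_sums (insert e E) (i + k)" if "b \<in> edge_sums E k" for i k b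
  proof (induction i)
    case 0
    then show ?case using that edge_sums_mono[of E "insert e E" k] by auto
  next
    case (Suc i)
    have "edge_mult (Suc i) e + b = (edge_mult i e + b) + edge_mult 1 e" by (simp add: edge_mult_Suc add_ac)
    also have "\<dots> \<in> edge_sums (insert e E) (Suc (i + k))" by (rule edge_sums_SucI[OF Suc]) simp
    finally show ?case by simp
  qed
  then show "x \<in> edge_sums (insert e E) d"
    if "\<exists>i k b. i + k = d \<and> b \<in> edge_sums E k \<and> x = edge_mult i e + b" using that by blast
qed

definition edge_series :: "'v set set \<Rightarrow> int fps" where
  "edge_series E = Abs_fps (\<lambda>d. int (card (edge_sums E d)))"

text \<open>
  The geometric series \<open>1 / (1 - z)\<close> is written as the series of ones, so that multiplying by it is summation.
\<close>

lemma fps_ones_nth: "fps_nth (Abs_fps (\<lambda>_. 1) * f) n = (\<Sum>i\<le>n. fps_nth f (n - i))" for f :: "'a::comm_ring_1 fps"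
  by (simp add: fps_mult_nth atLeast0AtMost)

lemma fps_ones_inverse: "Abs_fps (\<lambda>_. 1) * (1 - fps_X) = (1 :: 'a::comm_ring_1 fps)"
proof (rule fps_ext)
  fix n
  show "fps_nth (Abs_fps (\<lambda>_. 1) * (1 - fps_X)) n = fps_nth (1 :: 'a fps) n"
    by (cases n) (simp_all add: right_diff_distrib)
qed

lemma disjoint_by_value: "(\<And>x. x \<in> A \<Longrightarrow> f x = i) \<Longrightarrow> (\<And>x. x \<in> B \<Longrightarrow> f x = j) \<Longrightarrow> i \<noteq> j \<Longrightarrow> A \<inter> B = {}"
  by auto

text \<open>
  The coordinate at the new vertex \<open>v\<close> is the multiplicity of the new edge, so the sums of edges are those
  of the old graph plus an independent multiple of the new edge.
\<close>

lemma edge_series_pendant: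
  assumes E: "finite E" "\<forall>f\<in>E. finite f" "\<forall>f\<in>E. v \<notin> f" and e: "finite e" "v \<in> e"
  shows "edge_series (insert e E) * (1 - fps_X) = edge_series E"
proof -
  have "card (edge_sums (insert e E) d) = (\<Sum>i\<le>d. card (edge_sums E (d - i)))" for d
  proof -
    let ?A = "\<lambda>i. (\<lambda>b. edge_mult i e + b) ` edge_sums E (d - i)"
    have "edge_sums (insert e E) d = (\<Union>i\<in>{..d}. ?A i)"
    proof (rule Set.set_eqI)
      fix x
      have "x \<in> edge_sums (insert e E) d \<longleftrightarrow> (\<exists>i\<le>d. \<exists>b\<in>edge_sums E (d - i). x = edge_mult i e + b)"
        unfolding edge_sums_insert by (metis add_diff_cancel_left' le_add1 le_add_diff_inverse)
      then show "x \<in> edge_sums (insert e E) d \<longleftrightarrow> x \<in> (\<Union>i\<in>{..d}. ?A i)" by auto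
    qed
    moreover have key: "lookup x v = i" if "x \<in> ?A i" for x i
      using that e lookup_edge_sums_outside[OF E(3,2)] by (auto simp: lookup_add lookup_edge_mult)
    have "?A i \<inter> ?A j = {}" if "i \<noteq> j" for i j
      by (rule disjoint_by_value[where f="\<lambda>x. lookup x v", OF key key that])
    ultimately have "card (edge_sums (insert e E) d) = (\<Sum>i\<in>{..d}. card (?A i))"
      using E by (simp add: card_UN_disjoint)
    then show ?thesis by (simp add: card_image)
  qed
  then have "edge_series (insert e E) = Abs_fps (\<lambda>_. 1) * edge_series E"
    by (intro fps_ext) (simp only: fps_ones_nth, simp add: edge_series_def)
  then show ?thesis using fps_ones_inverse[where 'a=int] by (simp add: mult.commute mult.left_commute)
qed

lemma edge_exchange:
  assumes p: "\<forall>e\<in>E. p \<in> e \<longrightarrow> (\<exists>y. e = {p, y} \<and> Q y)" and "b \<in> edge_sums E k"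
  shows "b \<in> edge_sums {e \<in> E. p \<notin> e} k \<or>
    (\<exists>k' y b'. k = Suc k' \<and> Q y \<and> b' \<in> edge_sums E k' \<and> b = b' + edge_mult 1 {p, y})"
  using assms(2)
proof (induction k arbitrary: b)
  case (Suc k)
  from Suc.prems obtain a e where a: "a \<in> edge_sums E k" "e \<in> E" "b = a + edge_mult 1 e"
    by (rule edge_sums_SucE)
  show ?case
  proof (cases "p \<in> e")
    case True
    then show ?thesis using a p by blast
  next
    case False
    from Suc.IH[OF a(1)] show ?thesis
    proof
      assume "a \<in> edge_sums {e \<in> E. p \<notin> e} k"
      then show ?thesis using False a(2,3) edge_sums_SucI[of a "{e \<in> E. p \<notin> e}" k e] by blast
    next
      assume "\<exists>k' y b'. k = Suc k' \<and> Q y \<and> b' \<in> edge_sums E k' \<and> a = b' + edge_mult 1 {p, y}"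
      then obtain k' y b' where *: "k = Suc k'" "Q y" "b' \<in> edge_sums E k'" "a = b' + edge_mult 1 {p, y}"
        by blast
      then have "b' + edge_mult 1 e \<in> edge_sums E k" using edge_sums_SucI a(2) by blast
      moreover have "b = (b' + edge_mult 1 e) + edge_mult 1 {p, y}" using a(3) *(4) by (simp add: add_ac)
      ultimately show ?thesis using \<open>Q y\<close> by blast
    qed
  qed
qed simp

text \<open>
  While an edge \<open>{p, y}\<close> is in use, \<open>{v, q} + {p, y} = {v, p} + {q, y}\<close> lowers the multiplicity \<open>j\<close> of \<open>{v, q}\<close>;
  this ends with \<open>j = 0\<close> or with no edge of \<open>E\<close> at \<open>p\<close>.
\<close>

lemma edge_sums_ear_normal_form:
  assumes p: "\<forall>e\<in>E. p \<in> e \<longrightarrow> (\<exists>y. e = {p, y} \<and> {q, y} \<in> E \<and> y \<noteq> p \<and> y \<noteq> q)"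
    and "v \<noteq> p" "v \<noteq> q" and "b \<in> edge_sums E k"
  shows "(\<exists>i' k' b'. i' + k' = i + j + k \<and> b' \<in> edge_sums E k' \<and>
           edge_mult i {v, p} + edge_mult j {v, q} + b = edge_mult i' {v, p} + b') \<or>
         (\<exists>i' j' k' b'. i' + Suc j' + k' = i + j + k \<and> b' \<in> edge_sums {e \<in> E. p \<notin> e} k' \<and>
           edge_mult i {v, p} + edge_mult j {v, q} + b = edge_mult i' {v, p} + edge_mult (Suc j') {v, q} + b')"
  using assms(4)
proof (induction j arbitrary: i k b)
  case 0
  then show ?case by (intro disjI1 exI[of _ i] exI[of _ k] exI[of _ b]) simp
next
  case (Suc j)
  from edge_exchange[OF p Suc.prems] show ?case
  proof
    assume "b \<in> edge_sums {e \<in> E. p \<notin> e} k"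
    then show ?thesis by blast
  next
    assume "\<exists>k' y b'. k = Suc k' \<and> ({q, y} \<in> E \<and> y \<noteq> p \<and> y \<noteq> q) \<and> b' \<in> edge_sums E k' \<and>
      b = b' + edge_mult 1 {p, y}"
    then obtain k' y b' where *: "k = Suc k'" "{q, y} \<in> E" "y \<noteq> p" "y \<noteq> q"
      "b' \<in> edge_sums E k'" "b = b' + edge_mult 1 {p, y}" by blast
    then have b'': "b' + edge_mult 1 {q, y} \<in> edge_sums E k" using edge_sums_SucI by blast
    have exchange: "edge_mult 1 {v, q} + edge_mult 1 {p, y} = edge_mult 1 {v, p} + edge_mult 1 {q, y}"
      using * assms(2,3) by (simp add: edge_mult_def add_ac)
    have "edge_mult i {v, p} + edge_mult (Suc j) {v, q} + b =
        (edge_mult i {v, p} + edge_mult j {v, q} + b') + (edge_mult 1 {v, q} + edge_mult 1 {p, y})"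
      by (simp only: *(6) edge_mult_Suc add_ac)
    also have "\<dots> = edge_mult (Suc i) {v, p} + edge_mult j {v, q} + (b' + edge_mult 1 {q, y})"
      unfolding exchange by (simp only: edge_mult_Suc add_ac)
    finally have "edge_mult i {v, p} + edge_mult (Suc j) {v, q} + b =
        edge_mult (Suc i) {v, p} + edge_mult j {v, q} + (b' + edge_mult 1 {q, y})" .
    moreover have "i + Suc j + k = Suc i + j + k" by simp
    ultimately show ?thesis using Suc.IH[OF b'', of "Suc i"] by (simp only:)
  qed
qed

text \<open>
  The normal forms are unique: in those of the first kind the coordinate at \<open>v\<close> is at most the one at \<open>p\<close>, in those of the
  second kind it is larger, and in both the multiplicities can be read off from these two coordinates.
\<close>

lemma edge_series_ear:
  assumes E: "finite E" "\<forall>e\<in>E. finite e" "\<forall>e\<in>E. v \<notin> e"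
    and p: "\<forall>e\<in>E. p \<in> e \<longrightarrow> (\<exists>y. e = {p, y} \<and> {q, y} \<in> E \<and> y \<noteq> p \<and> y \<noteq> q)"
    and ne: "v \<noteq> p" "v \<noteq> q" "p \<noteq> q"
  shows "edge_series (insert {v, p} (insert {v, q} E)) * (1 - fps_X)\<^sup>2 =
    edge_series E * (1 - fps_X) + fps_X * edge_series {e \<in> E. p \<notin> e}"
proof -
  let ?F = "insert {v, p} (insert {v, q} E)"
  let ?E = "{e \<in> E. p \<notin> e}"
  let ?A = "\<lambda>d i. (\<lambda>b. edge_mult i {v, p} + b) ` edge_sums E (d - i)"
  let ?B = "\<lambda>d i j. (\<lambda>b. edge_mult i {v, p} + edge_mult (Suc j) {v, q} + b) ` edge_sums ?E (d - i - j)"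
  have mem: "x \<in> edge_sums ?F d \<longleftrightarrow>
    (\<exists>i j k b. i + j + k = d \<and> b \<in> edge_sums E k \<and> x = edge_mult i {v, p} + edge_mult j {v, q} + b)" for x d
  proof -
    have "x \<in> edge_sums ?F d \<longleftrightarrow> (\<exists>i l j k b. i + l = d \<and> j + k = l \<and> b \<in> edge_sums E k \<and>
        x = edge_mult i {v, p} + (edge_mult j {v, q} + b))"
      unfolding edge_sums_insert by blast
    then show ?thesis unfolding add.assoc by blast
  qed
  \<comment> \<open>The two kinds of normal form: without the edge \<open>{v, q}\<close>, or with it but then avoiding \<open>p\<close> in \<open>E\<close>.\<close>
  have dec: "x \<in> edge_sums ?F d \<longleftrightarrow> (\<exists>i k b. i + k = d \<and> b \<in> edge_sums E k \<and> x = edge_mult i {v, p} + b) \<or>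
    (\<exists>i j k b. i + Suc j + k = d \<and> b \<in> edge_sums ?E k \<and> x = edge_mult i {v, p} + edge_mult (Suc j) {v, q} + b)"
    (is "_ \<longleftrightarrow> ?a d x \<or> ?b d x") for x d
  proof
    assume "x \<in> edge_sums ?F d"
    then obtain i j k b where "i + j + k = d" "b \<in> edge_sums E k" "x = edge_mult i {v, p} + edge_mult j {v, q} + b"
      unfolding mem by blast
    then show "?a d x \<or> ?b d x"
      using edge_sums_ear_normal_form[OF p ne(1,2), of b k i j] by simp
  next
    assume "?a d x \<or> ?b d x"
    then show "x \<in> edge_sums ?F d"
    proof
      assume "?a d x"
      then obtain i k b where "i + k = d" "b \<in> edge_sums E k" "x = edge_mult i {v, p} + b" by blast
      then show ?thesis unfolding mem
        by (intro exI[of _ i] exI[of _ 0] exI[of _ k] exI[of _ b]) simp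
    next
      assume "?b d x"
      moreover have "edge_sums ?E k \<subseteq> edge_sums E k" for k by (rule edge_sums_mono) auto
      ultimately show ?thesis unfolding mem by blast
    qed
  qed
  have out: "lookup b v = 0" if "b \<in> edge_sums E k" for b k
    by (rule lookup_edge_sums_outside[OF E(3,2) that])
  have outE: "lookup b v = 0" "lookup b p = 0" if "b \<in> edge_sums ?E k" for b k
    using lookup_edge_sums_outside[OF _ _ that] E by auto
  \<comment> \<open>The coordinates at \<open>v\<close> and \<open>p\<close> determine the multiplicities \<open>i\<close> and \<open>j\<close>, and comparing them
    tells the two kinds apart.\<close>
  have A: "lookup x v = i" "lookup x v \<le> lookup x p" if "x \<in> ?A d i" for x d i
    using that out ne by (auto simp: lookup_add lookup_edge_mult)
  have B: "lookup x p = i" "lookup x v = i + Suc j" if "x \<in> ?B d i j" for x d i j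
    using that outE ne by (auto simp: lookup_add lookup_edge_mult)
  have cA: "card (\<Union>i\<in>{..d}. ?A d i) = (\<Sum>i\<le>d. card (edge_sums E (d - i)))" for d
  proof -
    have "?A d i \<inter> ?A d j = {}" if "i \<noteq> j" for i j
      by (rule disjoint_by_value[where f="\<lambda>x. lookup x v", OF A(1) A(1) that])
    then show ?thesis using E by (simp add: card_UN_disjoint card_image)
  qed
  have cB: "card (\<Union>i\<in>{..d}. \<Union>j\<in>{..d - i}. ?B d i j) =
      (\<Sum>i\<le>d. \<Sum>j\<le>d - i. card (edge_sums ?E (d - i - j)))" for d
  proof -
    have "?B d i j \<inter> ?B d i j' = {}" if "j \<noteq> j'" for i j j' :: nat
    proof -
      have "i + Suc j \<noteq> i + Suc j'" using that by arith
      show ?thesis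
        by (rule disjoint_by_value[where f="\<lambda>x. lookup x v"], erule B(2), erule B(2)) fact
    qed
    then have "card (\<Union>j\<in>{..d - i}. ?B d i j) = (\<Sum>j\<le>d - i. card (edge_sums ?E (d - i - j)))" for i
      using E by (simp add: card_UN_disjoint card_image)
    moreover have "(\<Union>j\<in>{..d - i}. ?B d i j) \<inter> (\<Union>j\<in>{..d - i'}. ?B d i' j) = {}" if "i \<noteq> i'" for i i'
    proof -
      have key: "lookup x p = l" if "x \<in> (\<Union>j\<in>{..d - l}. ?B d l j)" for x l
        using that by (elim UN_E) (rule B(1))
      show ?thesis
        by (rule disjoint_by_value[where f="\<lambda>x. lookup x p"], erule key, erule key) (rule that)
    qed
    ultimately show ?thesis using E by (simp add: card_UN_disjoint)
  qed
  have s0: "edge_sums ?F 0 = (\<Union>i\<in>{..0}. ?A 0 i)" by auto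
  have sSuc: "edge_sums ?F (Suc d) = (\<Union>i\<in>{..Suc d}. ?A (Suc d) i) \<union> (\<Union>i\<in>{..d}. \<Union>j\<in>{..d - i}. ?B d i j)" for d
  proof (rule Set.set_eqI)
    fix x
    have "(\<exists>i k b. i + k = Suc d \<and> b \<in> edge_sums E k \<and> x = edge_mult i {v, p} + b) \<longleftrightarrow>
      x \<in> (\<Union>i\<in>{..Suc d}. ?A (Suc d) i)"
    proof -
      have "(\<exists>i k b. i + k = Suc d \<and> b \<in> edge_sums E k \<and> x = edge_mult i {v, p} + b) \<longleftrightarrow>
        (\<exists>i\<le>Suc d. \<exists>b\<in>edge_sums E (Suc d - i). x = edge_mult i {v, p} + b)"
        by (metis add_diff_cancel_left' le_add1 le_add_diff_inverse)
      then show ?thesis by auto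
    qed
    moreover have "(\<exists>i j k b. i + Suc j + k = Suc d \<and> b \<in> edge_sums ?E k \<and>
        x = edge_mult i {v, p} + edge_mult (Suc j) {v, q} + b) \<longleftrightarrow>
      x \<in> (\<Union>i\<in>{..d}. \<Union>j\<in>{..d - i}. ?B d i j)" (is "?L \<longleftrightarrow> ?R")
    proof
      assume ?L
      then obtain i j k b where *: "i + Suc j + k = Suc d" "b \<in> edge_sums ?E k"
        "x = edge_mult i {v, p} + edge_mult (Suc j) {v, q} + b" by blast
      then have "i \<le> d" "j \<le> d - i" "d - i - j = k" by auto
      then show ?R using *(2,3) by blast
    next
      assume ?R
      then obtain i j b where *: "i \<le> d" "j \<le> d - i" "b \<in> edge_sums ?E (d - i - j)"
        "x = edge_mult i {v, p} + edge_mult (Suc j) {v, q} + b" by blast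
      then have "i + Suc j + (d - i - j) = Suc d" by auto
      then show ?L using *(3,4) by blast
    qed
    ultimately show "x \<in> edge_sums ?F (Suc d) \<longleftrightarrow>
      x \<in> (\<Union>i\<in>{..Suc d}. ?A (Suc d) i) \<union> (\<Union>i\<in>{..d}. \<Union>j\<in>{..d - i}. ?B d i j)"
      unfolding dec[of x "Suc d"] Un_iff by (simp only:)
  qed
  have disj: "(\<Union>i\<in>{..Suc d}. ?A (Suc d) i) \<inter> (\<Union>i\<in>{..d}. \<Union>j\<in>{..d - i}. ?B d i j) = {}" for d
  proof (rule ccontr)
    assume "\<not> ?thesis"
    then obtain x where x: "x \<in> (\<Union>i\<in>{..Suc d}. ?A (Suc d) i)" "x \<in> (\<Union>i\<in>{..d}. \<Union>j\<in>{..d - i}. ?B d i j)" by auto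
    from x(1) obtain i where xA: "x \<in> ?A (Suc d) i" by (rule UN_E)
    from x(2) obtain i' j where xB: "x \<in> ?B d i' j" by (elim UN_E)
    show False using A(2)[OF xA] B[OF xB] by linarith
  qed
  let ?G = "Abs_fps (\<lambda>_. 1) :: int fps"
  have "edge_series ?F = ?G * edge_series E + fps_X * (?G * (?G * edge_series ?E))"
  proof (rule fps_ext)
    fix d
    show "fps_nth (edge_series ?F) d = fps_nth (?G * edge_series E + fps_X * (?G * (?G * edge_series ?E))) d"
    proof (cases d)
      case 0
      have "card (edge_sums ?F 0) = (\<Sum>i\<le>0. card (edge_sums E (0 - i)))"
        unfolding s0 by (rule cA)
      then show ?thesis unfolding 0 fps_add_nth fps_ones_nth by (simp add: edge_series_def)
    next
      case (Suc d)
      have "card (edge_sums ?F (Suc d)) = (\<Sum>i\<le>Suc d. card (edge_sums E (Suc d - i))) +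
          (\<Sum>i\<le>d. \<Sum>j\<le>d - i. card (edge_sums ?E (d - i - j)))"
        unfolding sSuc by (subst card_Un_disjoint) (use disj E in \<open>simp_all only: cA cB\<close>, auto)
      then show ?thesis unfolding Suc fps_add_nth fps_ones_nth fps_X_mult_nth
        by (simp add: edge_series_def fps_ones_nth)
    qed
  qed
  then have "edge_series ?F * (1 - fps_X)\<^sup>2 =
      (?G * (1 - fps_X)) * (edge_series E * (1 - fps_X)) +
      (?G * (1 - fps_X)) * (?G * (1 - fps_X)) * (fps_X * edge_series ?E)"
    by (simp add: power2_eq_square algebra_simps)
  then show ?thesis unfolding fps_ones_inverse by simp
qed

declare One_nat_def [simp]

section \<open>Ladder graphs\<close>

text \<open>
  Rows and columns are added alternately, so transposing the array at every step allows both cases to be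
  treated as one. The vertex added in step \<open>n\<close> is \<open>side n (last_row n)\<close>, the one added before it is
  \<open>side (Suc n) (last_col n)\<close>.
\<close>

definition side :: "nat \<Rightarrow> nat \<Rightarrow> nat + nat" where
  "side n = (if even n then Inl else Inr)"

definition last_row :: "nat \<Rightarrow> nat" where "last_row n = (n + 1) div 2 + 2"
definition last_col :: "nat \<Rightarrow> nat" where "last_col n = n div 2 + 2"

text \<open>
  The nonempty positions, transposed for odd \<open>n\<close>, so that the row or column added last is always the last row.
\<close>

definition positions :: "nat \<Rightarrow> bit list \<Rightarrow> (nat \<times> nat) set" where
  "positions n t = (if even n then dom (ladder_array n t) else (dom (ladder_array n t))\<inverse>)"

definition pos_edges :: "(nat \<Rightarrow> 'v) \<Rightarrow> (nat \<Rightarrow> 'v) \<Rightarrow> (nat \<times> nat) set \<Rightarrow> 'v set set" where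
  "pos_edges f g D = (\<lambda>(i, j). {f i, g j}) ` D"

lemma pos_edges_converse: "pos_edges f g (D\<inverse>) = pos_edges g f D"
  by (force simp: pos_edges_def insert_commute)

definition ladder_edges :: "nat \<Rightarrow> bit list \<Rightarrow> (nat + nat) set set" where
  "ladder_edges n t = pos_edges (side n) (side (Suc n)) (positions n t)"

lemma ladder_edges_eq: "ladder_edges n t = pos_edges Inl Inr (dom (ladder_array n t))"
  by (simp add: ladder_edges_def side_def positions_def pos_edges_converse)

lemma last_row_Suc: "last_row (Suc n) = Suc (last_col n)"
  and last_col_Suc: "last_col (Suc n) = last_row n"
  by (simp_all add: last_row_def last_col_def)

lemma num_rows_eq: "num_rows n = (if even n then last_row n else last_col n)"
  and num_cols_eq: "num_cols n = (if even n then last_col n else last_row n)"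
  by (auto simp: num_rows_def num_cols_def last_row_def last_col_def elim!: evenE oddE)

text \<open>
  The local shape that the recursion reproduces: the last row has the entries \<open>u < c\<close>, the last column the entries
  \<open>w < y < r\<close>, and the column \<open>u\<close> meets the rows \<open>w\<close> and \<open>y\<close>. So the next vertex, attached to \<open>r\<close> and to one
  of \<open>w\<close> and \<open>y\<close>, is an ear: both neighbours \<open>u\<close> and \<open>c\<close> of \<open>r\<close> are also neighbours of \<open>w\<close> and of \<open>y\<close>.
\<close>

definition corner :: "(nat \<times> nat) set \<Rightarrow> nat \<Rightarrow> nat \<Rightarrow> nat \<Rightarrow> nat \<Rightarrow> nat \<Rightarrow> bool" where
  "corner D r c u w y \<longleftrightarrow> {j. (r, j) \<in> D} = {u, c} \<and> u < c \<and>
     {i. (i, c) \<in> D} = {w, y, r} \<and> w < y \<and> y < r \<and> (w, u) \<in> D \<and> (y, u) \<in> D"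

text \<open>
  After the new column and the transposition, the roles move on: the new last row has the entries \<open>q\<close> and
  \<open>r\<close>, and the new last column \<open>r\<close> has the entries \<open>u\<close>, \<open>c\<close> and the new one.
\<close>

lemma corner_step:
  assumes "corner D r c u w y" "q \<in> {w, y}" "D \<subseteq> {1..r} \<times> {1..c}"
  shows "corner ((D \<union> {(r, Suc c), (q, Suc c)})\<inverse>) (Suc c) r q u c"
proof -
  have row: "(r, j) \<in> D \<longleftrightarrow> j = u \<or> j = c" for j using assms(1) by (auto simp: corner_def set_eq_iff)
  have col: "(i, c) \<in> D \<longleftrightarrow> i = w \<or> i = y \<or> i = r" for i using assms(1) by (auto simp: corner_def set_eq_iff)
  have "(i, Suc c) \<notin> D" for i using assms(3) by auto
  moreover have "u < c" "w < y" "y < r" "(w, u) \<in> D" "(y, u) \<in> D" using assms(1) by (auto simp: corner_def)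
  ultimately show ?thesis unfolding corner_def using assms(2) row col by auto
qed

text \<open>
  The last column has the sorted entries \<open>w\<close>, \<open>y\<close>, \<open>last_row n\<close>, so its first or second entry is \<open>w\<close> or \<open>y\<close>.
\<close>

lemma positions_step:
  assumes n: "0 < n" and corner: "corner (positions n (butlast t)) (last_row n) (last_col n) u w y"
  shows "\<exists>q\<in>{w, y}. positions (Suc n) t =
    (positions n (butlast t) \<union> {(last_row n, Suc (last_col n)), (q, Suc (last_col n))})\<inverse>"
proof -
  obtain m where m: "n = Suc m" using n by (cases n) auto
  let ?L = "ladder_array n (butlast t)"
  define k where "k = (if last t = 0 then 0 else 1 :: nat)"
  define q where "q = [w, y, last_row n] ! k"
  have lt: "w < y" "y < last_row n" and col: "{i. (i, last_col n) \<in> positions n (butlast t)} = {w, y, last_row n}"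
    using corner by (auto simp: corner_def)
  have q: "q \<in> {w, y}" by (auto simp: q_def k_def)
  have sorted: "sorted_list_of_set {w, y, last_row n} = [w, y, last_row n]"
    using lt by (subst sorted_list_of_set.idem_if_sorted_distinct[symmetric]) auto
  show ?thesis
  proof (cases "even n")
    case True
    have "col_support ?L (num_cols (Suc n) - 1) = [w, y, last_row n]"
      using True col sorted by (simp add: col_support_def num_cols_eq last_row_Suc positions_def)
    then have "ladder_array (Suc n) t = ?L((last_row n, Suc (last_col n)) \<mapsto> 2 * Suc n + 4,
        (q, Suc (last_col n)) \<mapsto> 2 * Suc n + 3)"
      using True by (simp add: m Let_def num_rows_eq num_cols_eq last_row_Suc last_col_Suc q_def k_def)
    then have "positions (Suc n) t =
      (positions n (butlast t) \<union> {(last_row n, Suc (last_col n)), (q, Suc (last_col n))})\<inverse>"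
      using True by (auto simp: positions_def)
    then show ?thesis using q by blast
  next
    case False
    have "row_support ?L (num_rows (Suc n) - 1) = [w, y, last_row n]"
      using False col sorted by (simp add: row_support_def num_rows_eq last_row_Suc positions_def)
    then have "ladder_array (Suc n) t = ?L((Suc (last_col n), last_row n) \<mapsto> 2 * Suc n + 4,
        (Suc (last_col n), q) \<mapsto> 2 * Suc n + 3)"
      using False by (simp add: m Let_def num_rows_eq num_cols_eq last_row_Suc last_col_Suc q_def k_def)
    then have "positions (Suc n) t =
      (positions n (butlast t) \<union> {(last_row n, Suc (last_col n)), (q, Suc (last_col n))})\<inverse>"
      using False by (auto simp: positions_def)
    then show ?thesis using q by blast
  qed
qed

lemma positions_0: "positions 0 t = {(1, 1), (1, 2), (2, 1), (2, 2)}"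
  by (auto simp: positions_def split: if_splits)

lemma positions_1: "positions (Suc 0) t = {(1, 1), (2, 1), (3, 1), (1, 2), (2, 2), (3, 2)}"
  by (auto simp: positions_def split: if_splits)

lemma corner_positions:
  "0 < n \<Longrightarrow> positions n t \<subseteq> {1..last_row n} \<times> {1..last_col n} \<and>
    (\<exists>u w y. corner (positions n t) (last_row n) (last_col n) u w y)"
proof (induction n arbitrary: t)
  case (Suc n)
  show ?case
  proof (cases "n = 0")
    case True
    have "corner (positions (Suc 0) t) 3 2 1 1 2" unfolding positions_1 corner_def by auto
    moreover have "last_row (Suc 0) = 3" "last_col (Suc 0) = 2" by (simp_all add: last_row_def last_col_def)
    ultimately show ?thesis unfolding True by (auto simp: positions_1)
  next
    case False
    let ?D = "positions n (butlast t)"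
    from Suc.IH[of "butlast t"] False obtain u w y where
      D: "?D \<subseteq> {1..last_row n} \<times> {1..last_col n}" and c: "corner ?D (last_row n) (last_col n) u w y" by auto
    obtain q where q: "q \<in> {w, y}" and
      step: "positions (Suc n) t = (?D \<union> {(last_row n, Suc (last_col n)), (q, Suc (last_col n))})\<inverse>"
      using positions_step[OF _ c] False by blast
    have "(q, last_col n) \<in> ?D" using c q by (auto simp: corner_def)
    then have "q \<in> {1..last_row n}" using D by auto
    then have "positions (Suc n) t \<subseteq> {1..last_row (Suc n)} \<times> {1..last_col (Suc n)}"
      unfolding step last_row_Suc last_col_Suc using D by (auto simp: last_row_def)
    moreover have "corner (positions (Suc n) t) (last_row (Suc n)) (last_col (Suc n)) q u (last_col n)"
      unfolding step last_row_Suc last_col_Suc by (rule corner_step[OF c q D])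
    ultimately show ?thesis by blast
  qed
qed simp

lemma positions_bounds: "positions n t \<subseteq> {1..last_row n} \<times> {1..last_col n}"
proof (cases "n = 0")
  case True
  then show ?thesis by (simp add: positions_0 last_row_def last_col_def)
next
  case False
  then show ?thesis using corner_positions[of n t] by simp
qed

lemma dom_ladder_array_bounds: "dom (ladder_array n t) \<subseteq> {1..num_rows n} \<times> {1..num_cols n}"
proof
  fix x assume x: "x \<in> dom (ladder_array n t)"
  obtain i j where ij: "x = (i, j)" by (cases x)
  have "(if even n then (i, j) else (j, i)) \<in> positions n t" using x by (simp add: ij positions_def)
  then have "(if even n then (i, j) else (j, i)) \<in> {1..last_row n} \<times> {1..last_col n}"
    using positions_bounds by blast
  then show "x \<in> {1..num_rows n} \<times> {1..num_cols n}"
    by (cases "even n") (simp_all add: ij num_rows_eq num_cols_eq)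
qed

text \<open>
  The neighbours of the last row are among those of the row \<open>q\<close>: this is the hypothesis under which the new vertex is an
  ear. The value of \<open>t\<close> enters only through the choice of \<open>q\<close>.
\<close>

lemma positions_Suc:
  "\<exists>q. positions (Suc n) t =
    (positions n (butlast t) \<union> {(last_row n, Suc (last_col n)), (q, Suc (last_col n))})\<inverse> \<and> q < last_row n \<and>
    (\<forall>j. (last_row n, j) \<in> positions n (butlast t) \<longrightarrow> (q, j) \<in> positions n (butlast t))"
proof (cases "n = 0")
  case True
  then show ?thesis
    by (intro exI[of _ 1]) (auto simp: positions_0 positions_1 last_row_def last_col_def)
next
  case False
  obtain u w y where c: "corner (positions n (butlast t)) (last_row n) (last_col n) u w y"
    using corner_positions[of n "butlast t"] False by auto
  obtain q where q: "q \<in> {w, y}" and step: "positions (Suc n) t =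
      (positions n (butlast t) \<union> {(last_row n, Suc (last_col n)), (q, Suc (last_col n))})\<inverse>"
    using positions_step[OF _ c] False by blast
  have "q < last_row n" using c q by (auto simp: corner_def)
  moreover have "(q, j) \<in> positions n (butlast t)" if "(last_row n, j) \<in> positions n (butlast t)" for j
  proof -
    have "j \<in> {u, last_col n}" using c that by (auto simp: corner_def)
    then show ?thesis using c q by (auto simp: corner_def)
  qed
  ultimately show ?thesis using step by blast
qed

lemma positions_remove_last_row:
  "{x \<in> positions (Suc n) t. fst x \<noteq> last_row (Suc n)} = (positions n (butlast t))\<inverse>"
proof -
  obtain q where "positions (Suc n) t =
    (positions n (butlast t) \<union> {(last_row n, Suc (last_col n)), (q, Suc (last_col n))})\<inverse>"
    using positions_Suc[of n t] by blast
  then show ?thesis using positions_bounds[of n "butlast t"] by (auto simp: last_row_Suc)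
qed

lemma finite_positions: "finite (positions n t)"
  by (rule finite_subset[OF positions_bounds]) simp

lemma finite_ladder_edges: "finite (ladder_edges n t)"
  by (simp add: ladder_edges_def pos_edges_def finite_positions)

lemma side_inject [simp]: "side n i = side n j \<longleftrightarrow> i = j"
  and side_Suc_neq [simp]: "side n i \<noteq> side (Suc n) j" "side (Suc n) j \<noteq> side n i"
  by (auto simp: side_def)

lemma side_Suc_Suc [simp]: "side (Suc (Suc n)) = side n"
  by (simp add: side_def)

lemma ladder_edges_Suc:
  "\<exists>q. ladder_edges (Suc n) t = insert {side (Suc n) (last_row (Suc n)), side n (last_row n)}
      (insert {side (Suc n) (last_row (Suc n)), side n q} (ladder_edges n (butlast t))) \<and> q < last_row n \<and>
    (\<forall>j. {side n (last_row n), side (Suc n) j} \<in> ladder_edges n (butlast t) \<longrightarrow>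
      {side n q, side (Suc n) j} \<in> ladder_edges n (butlast t))"
proof -
  let ?D = "positions n (butlast t)"
  obtain q where q: "positions (Suc n) t =
    (?D \<union> {(last_row n, Suc (last_col n)), (q, Suc (last_col n))})\<inverse>" "q < last_row n"
    and sub: "\<forall>j. (last_row n, j) \<in> ?D \<longrightarrow> (q, j) \<in> ?D"
    using positions_Suc[of n t] by blast
  have mem: "{side n i, side (Suc n) j} \<in> ladder_edges n (butlast t) \<longleftrightarrow> (i, j) \<in> ?D" for i j
    by (auto simp: ladder_edges_def pos_edges_def doubleton_eq_iff image_iff)
  have "ladder_edges (Suc n) t = pos_edges (side n) (side (Suc n))
      (?D \<union> {(last_row n, Suc (last_col n)), (q, Suc (last_col n))})"
    unfolding ladder_edges_def q(1) side_Suc_Suc by (rule pos_edges_converse)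
  also have "\<dots> = insert {side (Suc n) (last_row (Suc n)), side n (last_row n)}
      (insert {side (Suc n) (last_row (Suc n)), side n q} (ladder_edges n (butlast t)))"
    by (auto simp: pos_edges_def ladder_edges_def last_row_Suc insert_commute)
  finally have E: "ladder_edges (Suc n) t = \<dots>" .
  then show ?thesis using q(2) sub by (auto simp: mem)
qed

lemma ladder_edgesE:
  assumes "e \<in> ladder_edges n t"
  obtains i j where "e = {side n i, side (Suc n) j}" "i \<le> last_row n" "j \<le> last_col n"
  using assms positions_bounds[of n t] by (auto simp: ladder_edges_def pos_edges_def)

text \<open>
  Removing the vertex added last undoes the last step. In the recursion for an ear this is applied to the
  vertex added before the ear, so that its second term belongs to the ladder graph two steps back.
\<close>

lemma ladder_edges_remove_last:
  "{e \<in> ladder_edges (Suc n) t. side (Suc n) (last_row (Suc n)) \<notin> e} = ladder_edges n (butlast t)"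
proof -
  have "{e \<in> ladder_edges (Suc n) t. side (Suc n) (last_row (Suc n)) \<notin> e} =
    pos_edges (side (Suc n)) (side n) {x \<in> positions (Suc n) t. fst x \<noteq> last_row (Suc n)}"
    by (auto simp: ladder_edges_def pos_edges_def)
  then show ?thesis by (simp add: positions_remove_last_row pos_edges_converse ladder_edges_def)
qed

lemma new_vertex_notin: "e \<in> ladder_edges n t \<Longrightarrow> side (Suc n) (last_row (Suc n)) \<notin> e"
  by (erule ladder_edgesE) (auto simp: last_row_Suc)

text \<open>
  The vertices in an order in which each one after the first is adjacent to an earlier one.
\<close>

fun vertex_list :: "nat \<Rightarrow> (nat + nat) list" where
  "vertex_list 0 = [Inl 1, Inr 1, Inr 2, Inl 2]"
| "vertex_list (Suc n) = vertex_list n @ [side (Suc n) (last_row (Suc n))]"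

lemma length_vertex_list [simp]: "length (vertex_list n) = n + 4"
  by (induction n) auto

lemma last_vertex_list: "vertex_list n ! (n + 3) = side n (last_row n)"
proof (cases n)
  case 0
  then show ?thesis by (simp add: side_def last_row_def eval_nat_numeral)
next
  case (Suc m)
  then show ?thesis by (simp add: nth_append)
qed

lemma set_vertex_list: "set (vertex_list n) = Inl ` {1..num_rows n} \<union> Inr ` {1..num_cols n}"
proof (induction n)
  case 0
  have "num_rows 0 = 2" "num_cols 0 = 2" by (simp_all add: num_rows_def num_cols_def)
  moreover have "{1..2} = {1, 2 :: nat}" by auto
  ultimately show ?case
    by (simp only: vertex_list.simps list.set image_insert image_empty Un_insert_left Un_empty_left) blast
next
  case (Suc n)
  have atMost: "{1..Suc k} = insert (Suc k) {1..k}" for k by auto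
  show ?case
    by (cases "even n")
       (auto simp: Suc side_def num_rows_eq num_cols_eq last_row_Suc last_col_Suc atMost)
qed

lemma distinct_vertex_list: "distinct (vertex_list n)"
proof (induction n)
  case (Suc n)
  have "side (Suc n) (last_row (Suc n)) \<notin> set (vertex_list n)"
    unfolding set_vertex_list by (auto simp: side_def num_rows_eq num_cols_eq last_row_Suc)
  then show ?case using Suc by simp
qed simp

lemma vertex_list_connected:
  "0 < k \<Longrightarrow> k < n + 4 \<Longrightarrow> \<exists>j<k. {vertex_list n ! j, vertex_list n ! k} \<in> ladder_edges n t"
proof (induction n arbitrary: t k)
  case 0
  have E: "ladder_edges 0 t = {{Inl 1, Inr 1}, {Inl 1, Inr 2}, {Inl 2, Inr 1}, {Inl 2, Inr 2}}"
    by (simp add: ladder_edges_def pos_edges_def positions_0 side_def)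
  consider "k = 1" | "k = 2" | "k = 3" using 0 by linarith
  then show ?case
  proof cases
    case 1
    then show ?thesis unfolding E by (intro exI[of _ 0]) simp
  next
    case 2
    then show ?thesis unfolding E by (intro exI[of _ 0]) simp
  next
    case 3
    then show ?thesis unfolding E by (intro exI[of _ 1]) (simp add: eval_nat_numeral insert_commute)
  qed
next
  case (Suc n)
  obtain q where E: "ladder_edges (Suc n) t = insert {side (Suc n) (last_row (Suc n)), side n (last_row n)}
      (insert {side (Suc n) (last_row (Suc n)), side n q} (ladder_edges n (butlast t)))"
    using ladder_edges_Suc[of n t] by blast
  show ?case
  proof (cases "k < n + 4")
    case True
    then obtain j where "j < k" "{vertex_list n ! j, vertex_list n ! k} \<in> ladder_edges n (butlast t)"
      using Suc by blast
    then show ?thesis using True unfolding E by (intro exI[of _ j]) (simp add: nth_append)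
  next
    case False
    then have "k = n + 4" using Suc.prems by simp
    then show ?thesis unfolding E
      by (intro exI[of _ "n + 3"]) (simp add: nth_append last_vertex_list insert_commute)
  qed
qed

lemma inj_on_map_upd:
  assumes "inj_on L (dom L)" "x \<notin> ran L"
  shows "inj_on (L(a \<mapsto> x)) (dom (L(a \<mapsto> x)))"
  using assms by (auto simp: inj_on_def ran_def dom_def)

lemma ran_map_upd_subset: "ran (L(a \<mapsto> x)) \<subseteq> insert x (ran L)"
  by (auto simp: ran_def)

lemma ran_map_upd_le: "ran L \<subseteq> S \<Longrightarrow> x \<in> S \<Longrightarrow> ran (L(a \<mapsto> x)) \<subseteq> S"
  using ran_map_upd_subset[of L a x] by blast

text \<open>
  The two labels of step \<open>n\<close> exceed all earlier ones.
\<close>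

lemma ladder_array_inj:
  "inj_on (ladder_array n t) (dom (ladder_array n t)) \<and> ran (ladder_array n t) \<subseteq> {..2 * n + 4}"
proof (induction n t rule: ladder_array.induct)
  case (3 m t)
  let ?L = "ladder_array (Suc m) (butlast t)"
  have "\<exists>a b. ladder_array (Suc (Suc m)) t =
      ?L(a \<mapsto> 2 * Suc (Suc m) + 4, b \<mapsto> 2 * Suc (Suc m) + 3)"
    by (simp add: Let_def) blast
  then obtain a b where eq: "ladder_array (Suc (Suc m)) t =
      ?L(a \<mapsto> 2 * Suc (Suc m) + 4, b \<mapsto> 2 * Suc (Suc m) + 3)" by blast
  let ?L' = "?L(a \<mapsto> 2 * Suc (Suc m) + 4)"
  have IH: "inj_on ?L (dom ?L)" "ran ?L \<subseteq> {..2 * Suc m + 4}" using 3 by auto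
  have "inj_on ?L' (dom ?L')" by (rule inj_on_map_upd) (use IH in auto)
  moreover have ran': "ran ?L' \<subseteq> insert (2 * Suc (Suc m) + 4) {..2 * Suc m + 4}"
    using ran_map_upd_subset[of ?L a] IH(2) by blast
  then have "2 * Suc (Suc m) + 3 \<notin> ran ?L'" by auto
  ultimately have "inj_on (?L'(b \<mapsto> 2 * Suc (Suc m) + 3)) (dom (?L'(b \<mapsto> 2 * Suc (Suc m) + 3)))"
    by (rule inj_on_map_upd)
  moreover have "ran (?L'(b \<mapsto> 2 * Suc (Suc m) + 3)) \<subseteq> insert (2 * Suc (Suc m) + 3) (ran ?L')"
    by (rule ran_map_upd_subset)
  then have "ran (?L'(b \<mapsto> 2 * Suc (Suc m) + 3)) \<subseteq> {..2 * Suc (Suc m) + 4}" using ran' by fastforce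
  ultimately show ?case unfolding eq by blast
next
  case (1 t)
  have "ran (ladder_array 0 t) \<subseteq> {..2 * 0 + 4}"
    unfolding ladder_array.simps by (intro ran_map_upd_le) simp_all
  moreover have "dom (ladder_array 0 t) = {(1, 1), (1, 2), (2, 1), (2, 2)}"
    by (auto split: if_splits)
  moreover have "inj_on (ladder_array 0 t) {(1, 1), (1, 2), (2, 1), (2, 2)}"
    by (simp add: inj_on_def)
  ultimately show ?case by (simp only: simp_thms)
next
  case (2 t)
  have "ran (ladder_array (Suc 0) t) \<subseteq> {..2 * Suc 0 + 4}"
    unfolding ladder_array.simps by (intro ran_map_upd_le) simp_all
  moreover have "dom (ladder_array (Suc 0) t) = {(1, 1), (1, 2), (1, 3), (2, 1), (2, 2), (2, 3)}"
    by (auto split: if_splits)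
  moreover have "inj_on (ladder_array (Suc 0) t) {(1, 1), (1, 2), (1, 3), (2, 1), (2, 2), (2, 3)}"
    by (simp add: inj_on_def)
  ultimately show ?case by (simp only: simp_thms)
qed

lemma ends_ladder_graph:
  assumes "ladder_array n t (i, j) = Some e"
  shows "ends (ladder_graph n t) e = {Inl i, Inr j}"
proof -
  have "(i', j') = (i, j)" if "ladder_array n t (i', j') = Some e" for i' j'
    using ladder_array_inj[of n t] assms that unfolding inj_on_def by (metis domI)
  then have "{{Inl i', Inr j'} | i' j'. ladder_array n t (i', j') = Some e} = {{Inl i, Inr j}}"
    using assms by blast
  then show ?thesis by (simp add: ladder_graph_def)
qed

lemma ends_edges_ladder_graph:
  "ends (ladder_graph n t) ` edges (ladder_graph n t) = ladder_edges n t"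
proof -
  have "ends (ladder_graph n t) ` edges (ladder_graph n t) =
    {ends (ladder_graph n t) e | e i j. ladder_array n t (i, j) = Some e}"
    by (auto simp: ladder_graph_def ran_def)
  also have "\<dots> = {{Inl i, Inr j} | i j. (i, j) \<in> dom (ladder_array n t)}"
    using ends_ladder_graph[of n t] by (auto simp: dom_def) metis+
  finally show ?thesis by (auto simp: ladder_edges_eq pos_edges_def)
qed

section \<open>Hilbert series and multiplicity of the ladder rings\<close>

text \<open>
  The numerators of the Hilbert series, shifted by two: the recursion starts with a single edge and the path with two edges,
  both of which have numerator 1, so that \<open>h_poly (n + 2)\<close> belongs to the ladder graph with index \<open>n\<close>.
\<close>

fun h_poly :: "nat \<Rightarrow> int poly" where
  "h_poly 0 = 1"
| "h_poly (Suc 0) = 1"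
| "h_poly (Suc (Suc n)) = h_poly (Suc n) + [:0, 1:] * h_poly n"

lemma poly_h_poly_1: "poly (h_poly n) 1 = int (fib (Suc n))"
  by (induction n rule: h_poly.induct) simp_all

lemma fps_h_poly_Suc_Suc:
  "fps_of_poly (h_poly (Suc (Suc n))) = fps_of_poly (h_poly (Suc n)) + fps_X * fps_of_poly (h_poly n)"
  by (simp only: h_poly.simps fps_of_poly_add fps_of_poly_mult fps_of_poly_fps_X)

lemma edge_series_ladder_Suc:
  "edge_series (ladder_edges (Suc n) t) * (1 - fps_X)\<^sup>2 =
    edge_series (ladder_edges n (butlast t)) * (1 - fps_X) +
    fps_X * edge_series {e \<in> ladder_edges n (butlast t). side n (last_row n) \<notin> e}"
proof -
  let ?E = "ladder_edges n (butlast t)"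
  obtain q where E: "ladder_edges (Suc n) t = insert {side (Suc n) (last_row (Suc n)), side n (last_row n)}
      (insert {side (Suc n) (last_row (Suc n)), side n q} ?E)"
    and q: "q < last_row n"
    and nbr: "\<And>j. {side n (last_row n), side (Suc n) j} \<in> ?E \<Longrightarrow> {side n q, side (Suc n) j} \<in> ?E"
    using ladder_edges_Suc[of n t] by blast
  show ?thesis unfolding E
  proof (rule edge_series_ear)
    show "\<forall>e\<in>?E. finite e" by (auto elim: ladder_edgesE)
    show "\<forall>e\<in>?E. side n (last_row n) \<in> e \<longrightarrow>
      (\<exists>y. e = {side n (last_row n), y} \<and> {side n q, y} \<in> ?E \<and> y \<noteq> side n (last_row n) \<and> y \<noteq> side n q)"
    proof (intro ballI impI)
      fix e assume e: "e \<in> ?E" "side n (last_row n) \<in> e"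
      obtain i j where "e = {side n i, side (Suc n) j}" using e(1) by (rule ladder_edgesE)
      then have eq: "e = {side n (last_row n), side (Suc n) j}" using e(2) by auto
      then show "\<exists>y. e = {side n (last_row n), y} \<and> {side n q, y} \<in> ?E \<and>
          y \<noteq> side n (last_row n) \<and> y \<noteq> side n q"
        using e(1) nbr by (intro exI[of _ "side (Suc n) j"]) auto
    qed
  qed (use q in \<open>auto simp: finite_ladder_edges new_vertex_notin\<close>)
qed

lemma edge_series_star:
  "edge_series {{Inl 1 :: nat + nat, Inr 1 :: nat + nat}} * (1 - fps_X) = 1"
  "edge_series {{Inl 1 :: nat + nat, Inr 2 :: nat + nat}, {Inl 1, Inr 1}} * (1 - fps_X) =
    edge_series {{Inl 1 :: nat + nat, Inr 1 :: nat + nat}}"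
proof -
  have "edge_series ({} :: (nat + nat) set set) = 1"
  proof (rule fps_ext)
    fix d
    have "edge_sums ({} :: (nat + nat) set set) (Suc k) = {}" for k by simp
    then show "fps_nth (edge_series ({} :: (nat + nat) set set)) d = fps_nth 1 d"
      by (cases d) (simp_all add: edge_series_def)
  qed
  then show "edge_series {{Inl 1 :: nat + nat, Inr 1 :: nat + nat}} * (1 - fps_X) = 1"
    using edge_series_pendant[of "{}" "Inr 1" "{Inl 1, Inr 1 :: nat + nat}"] by simp
  show "edge_series {{Inl 1 :: nat + nat, Inr 2 :: nat + nat}, {Inl 1, Inr 1}} * (1 - fps_X) =
    edge_series {{Inl 1 :: nat + nat, Inr 1 :: nat + nat}}"
    by (rule edge_series_pendant[of _ "Inr 2"]) auto
qed

lemma edge_series_ladder_base: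
  "edge_series (ladder_edges 0 t) * (1 - fps_X) ^ 3 = fps_of_poly (h_poly 2)"
  "edge_series {e \<in> ladder_edges 0 t. Inl 2 \<notin> e} * (1 - fps_X)\<^sup>2 = fps_of_poly (h_poly 1)"
proof -
  let ?e = "{Inl 1, Inr 1} :: (nat + nat) set"
  let ?E = "{{Inl 1, Inr 2 :: nat + nat}, {Inl 1, Inr 1}}"
  let ?x = "1 - fps_X :: int fps"
  \<comment> \<open>The four-cycle is the path around row 1 with the ear row 2 attached to both of its ends.\<close>
  have E: "ladder_edges 0 t = insert {Inl 2, Inr 2} (insert {Inl 2, Inr 1} ?E)"
    by (auto simp: ladder_edges_def pos_edges_def positions_0 side_def)
  have path: "edge_series ?E * ?x * ?x = 1" using edge_series_star by simp
  have "{e \<in> ladder_edges 0 t. Inl 2 \<notin> e} = ?E" unfolding E by auto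
  then show "edge_series {e \<in> ladder_edges 0 t. Inl 2 \<notin> e} * ?x\<^sup>2 = fps_of_poly (h_poly 1)"
    using path by (simp add: power2_eq_square mult.assoc)
  have "edge_series (ladder_edges 0 t) * ?x\<^sup>2 =
      edge_series ?E * ?x + fps_X * edge_series {e \<in> ?E. Inr 2 \<notin> e}"
    unfolding E by (rule edge_series_ear) auto
  moreover have "{e \<in> ?E. Inr 2 \<notin> e} = {?e}" by auto
  ultimately have "edge_series (ladder_edges 0 t) * ?x\<^sup>2 = edge_series ?E * ?x + fps_X * edge_series {?e}"
    by simp
  then have "edge_series (ladder_edges 0 t) * ?x\<^sup>2 * ?x =
      (edge_series ?E * ?x + fps_X * edge_series {?e}) * ?x" by (simp only:)
  also have "\<dots> = edge_series ?E * ?x * ?x + fps_X * (edge_series {?e} * ?x)"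
    by (simp only: distrib_right mult.assoc)
  also have "\<dots> = 1 + fps_X" using path edge_series_star(1) by simp
  also have "\<dots> = fps_of_poly (h_poly 2)"
    using fps_h_poly_Suc_Suc[of 0] by (simp add: numeral_2_eq_2)
  finally show "edge_series (ladder_edges 0 t) * ?x ^ 3 = fps_of_poly (h_poly 2)"
    by (simp only: power3_eq_cube power2_eq_square mult.assoc)
qed

theorem edge_series_ladder:
  "edge_series (ladder_edges n t) * (1 - fps_X) ^ (n + 3) = fps_of_poly (h_poly (n + 2))"
proof (induction n arbitrary: t rule: less_induct)
  case (less n)
  let ?x = "1 - fps_X :: int fps"
  show ?case
  proof (cases n)
    case 0
    then show ?thesis using edge_series_ladder_base(1) by (simp only: add_0)
  next
    case (Suc m)
    let ?F = "{e \<in> ladder_edges m (butlast t). side m (last_row m) \<notin> e}"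
    have F: "edge_series ?F * ?x ^ (m + 2) = fps_of_poly (h_poly (m + 1))"
    proof (cases m)
      case 0
      then have "?F = {e \<in> ladder_edges 0 (butlast t). Inl 2 \<notin> e}" by (simp add: side_def last_row_def numeral_2_eq_2)
      then show ?thesis using edge_series_ladder_base(2) 0 by (simp only: add_0)
    next
      case (Suc l)
      then have F: "?F = ladder_edges l (butlast (butlast t))" using ladder_edges_remove_last by simp
      have exps: "m + 2 = l + 3" "m + 1 = l + 2" using Suc by simp_all
      show ?thesis unfolding F exps by (rule less) (simp add: \<open>n = Suc m\<close> Suc)
    qed
    have power: "?x ^ (m + 3) = ?x * ?x ^ (m + 2)" by (simp add: eval_nat_numeral)
    have "edge_series (ladder_edges n t) * ?x ^ (n + 3) =
        (edge_series (ladder_edges (Suc m) t) * ?x\<^sup>2) * ?x ^ (m + 2)"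
    proof -
      have "n + 3 = 2 + (m + 2)" using Suc by simp
      then show ?thesis unfolding Suc by (simp only: power_add mult.assoc)
    qed
    also have "\<dots> = edge_series (ladder_edges m (butlast t)) * ?x ^ (m + 3) + fps_X * (edge_series ?F * ?x ^ (m + 2))"
      unfolding edge_series_ladder_Suc power by (simp only: distrib_right mult.assoc)
    also have "\<dots> = fps_of_poly (h_poly (n + 2))"
    proof -
      have "n + 2 = Suc (Suc (m + 1))" "m + 2 = Suc (m + 1)" "m < n" using Suc by simp_all
      then show ?thesis using less[of m] F fps_h_poly_Suc_Suc[of "m + 1"] by (simp only:)
    qed
    finally show ?thesis .
  qed
qed

lemma ladder_mult_eq_fib: "ladder_mult TYPE('k::field) n t = int (fib (n + 3))"
proof -
  let ?G = "ladder_graph n t"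
  let ?A = "Inl ` {1..num_rows n} :: (nat + nat) set"
  let ?B = "Inr ` {1..num_cols n} :: (nat + nat) set"
  let ?R = "toric_ring ?G :: (nat, 'k) mpoly set graded_algebra"
  have bip: "bipartite ?G ?A ?B"
    unfolding bipartite_def
  proof (intro conjI ballI)
    fix e assume "e \<in> edges ?G"
    then obtain i j where ij: "ladder_array n t (i, j) = Some e"
      by (auto simp: ladder_graph_def ran_def)
    then have "(i, j) \<in> dom (ladder_array n t)" by blast
    then have "i \<in> {1..num_rows n} \<and> j \<in> {1..num_cols n}"
      using dom_ladder_array_bounds[of n t] by blast
    then show "\<exists>a\<in>?A. \<exists>b\<in>?B. ends ?G e = {a, b}" using ends_ladder_graph[OF ij] by blast
  qed auto
  have "num_rows n \<ge> 1" by (simp add: num_rows_def)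
  then have "?A \<noteq> {}" by simp
  then have "krull_dim (alg_ring ?R) = enat (length (vertex_list n) - 1)"
    by (intro krull_dim_connected_bipartite[OF bip distinct_vertex_list set_vertex_list])
       (use vertex_list_connected[of _ n t] in \<open>auto simp: ends_edges_ladder_graph\<close>)
  then have dim: "krull_dim (alg_ring ?R) = enat (n + 3)" by simp
  have "hilbert_function ?R d = card (edge_sums (ladder_edges n t) d)" for d
    using hilbert_function_toric_ring[of ?G d, where 'k='k] finite_edge_sums[OF finite_ladder_edges, of n t d]
    by (simp add: deg_vecs_eq_edge_sums ends_edges_ladder_graph)
  then have "hilbert_series ?R = edge_series (ladder_edges n t)"
    by (simp add: hilbert_series_def edge_series_def)
  then have series: "hilbert_series ?R * (1 - fps_X) ^ the_enat (krull_dim (alg_ring ?R)) =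
      fps_of_poly (h_poly (n + 2))"
    by (simp only: dim the_enat.simps edge_series_ladder)
  have "hilbert_multiplicity ?R = poly (h_poly (n + 2)) 1"
    unfolding hilbert_multiplicity_def series by simp
  then show ?thesis
    by (simp only: ladder_mult_def ladder_ring_def poly_h_poly_1) (simp add: eval_nat_numeral)
qed

theorem corollary1p6:
  shows "(\<forall>n\<ge>2. \<forall>t t' t''. length t = n + 1 \<longrightarrow> length t' = n \<longrightarrow> length t'' = n - 1 \<longrightarrow>
            ladder_mult TYPE('k::field) n t =
              ladder_mult TYPE('k) (n - 1) t' + ladder_mult TYPE('k) (n - 2) t'') \<and>
         (\<forall>n t. length t = n + 1 \<longrightarrow>
            ladder_mult TYPE('k) n t = int (fib (n + 3)) \<and>
            real_of_int (ladder_mult TYPE('k) n t) =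
              ((1 + sqrt 5) ^ (n + 3) - (1 - sqrt 5) ^ (n + 3)) / (2 ^ (n + 3) * sqrt 5))"
proof (intro conjI allI impI)
  fix n :: nat and t t' t'' :: "bit list"
  assume "2 \<le> n"
  then obtain m where "n = m + 2" using le_Suc_ex by (metis add.commute)
  then show "ladder_mult TYPE('k) n t = ladder_mult TYPE('k) (n - 1) t' + ladder_mult TYPE('k) (n - 2) t''"
    by (simp add: ladder_mult_eq_fib eval_nat_numeral)
next
  fix n :: nat and t :: "bit list"
  show "ladder_mult TYPE('k) n t = int (fib (n + 3))" by (rule ladder_mult_eq_fib)
  show "real_of_int (ladder_mult TYPE('k) n t) =
      ((1 + sqrt 5) ^ (n + 3) - (1 - sqrt 5) ^ (n + 3)) / (2 ^ (n + 3) * sqrt 5)"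
    unfolding ladder_mult_eq_fib of_int_of_nat_eq fib_closed_form
    by (simp only: power_divide diff_divide_distrib[symmetric] divide_divide_eq_left)
qed

end
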